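(* Suppose $P_{n,K}$ is full-dimensional. Let $S$ and $T$ be two disjoint non-empty subsets of $V$, and let $U=V\setminus(S\cup T)$. The 2-partition inequality $$\sum_{s\in S}\sum_{t\in T}x_{s,t}-\sum_{\{s,s'\}\subset S,\,s<s'}x_{s,s'}-\sum_{\{t,t'\}\subset T,\,t<t'}x_{t,t'}\le\min(|S|,|T|)$$ is facet-defining for $P_{n,K}$ if and only if the following conditions are satisfied: (i) $|T|-|S|\in\{1,2,\dots,K-1\}$; (ii) $|S|\le n-(K+2)$; (iii) for every $s\in S$ there exists $t\in T$ with $t>s$; (iv) if $|S|=1$, then there exists $u\in U\cap\{1,2,3\}$.
   Context: $V=\{1,\dots,n\}$ and $E$ is the set of all unordered pairs $ij$ of distinct elements of $V$; $x_{i,j}=x_{j,i}$. A $K$-partition $\pi$ is a collection of $K$ non-empty pairwise disjoint subsets (clusters) of $V$ whose union is $V$. The representative of a cluster is its smallest element. The characteristic vector $x^\pi\in\{0,1\}^{|E|+|V|-3}$ of $\pi$ has components $x_4,\dots,x_n$ and $x_{i,j}$ for $ij\in E$, where $x^\pi_{i,j}=1$ if $i,j$ are in the same cluster and $0$ otherwise, and $x^\pi_u=1$ if $u$ is the representative of its cluster and $0$ otherwise. (Representative variables of vertices $1,2,3$ are not coordinates.) $P_{n,K}\subset\mathbb R^{|E|+|V|-3}$ is the convex hull of the characteristic vectors $x^\pi$ of all $K$-partitions $\pi$ of $V$ (equivalently, of all $0/1$ solutions of the integer formulation of the $K$-partitioning problem). It is full-dimensional (dimension $|E|+|V|-3$)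 if and only if $K\in\{3,\dots,n-2\}$. An inequality is facet-defining for $P_{n,K}$ if it is valid for $P_{n,K}$ and the set of points of $P_{n,K}$ satisfying it with equality has dimension $\dim(P_{n,K})-1$.
   Formalization: The condition |S| ≤ |T| is added: the inequality is symmetric in S and T but (i) is not, so the equivalence fails for |S| > |T| (e.g. n=6, K=3, S={3,4}, T={2} is facet-defining but violates (i)); that case is covered by exchanging S and T. *)

theory Defs
  imports "HOL-Analysis.Analysis" "HOL-Library.Disjoint_Sets"
begin

text \<open>The coordinates: \<open>Edge {i, j}\<close> stands for $x_{i,j}$ and \<open>Rep u\<close> for $x_u$.\<close>

datatype coord = Edge "nat set" | Rep nat

definition coords :: "nat \<Rightarrow> coord set" where
  "coords n = Edge ` {{i, j} | i j. i \<in> {1..n} \<and> j \<in> {1..n} \<and> i \<noteq> j} \<union> Rep ` {4..n}"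

definition K_partition :: "nat \<Rightarrow> nat \<Rightarrow> nat set set \<Rightarrow> bool" where
  "K_partition n K \<pi> \<longleftrightarrow> partition_on {1..n} \<pi> \<and> card \<pi> = K"

fun char_component :: "nat set set \<Rightarrow> coord \<Rightarrow> real" where
  "char_component \<pi> (Edge e) = of_bool (\<exists>C\<in>\<pi>. e \<subseteq> C)"
| "char_component \<pi> (Rep u) = of_bool (\<exists>C\<in>\<pi>. u \<in> C \<and> u = Min C)"

text \<open>
  The space $\mathbb{R}^{|E|+|V|-3}$ is the type \<open>real ^ 'c\<close>, where \<open>'c\<close> is any finite
  type whose elements are put in one-to-one correspondence with the coordinates
  by a labelling \<open>idx\<close>, i.e. \<open>bij_betw idx (coords n) UNIV\<close>.
\<close>

definition char_vector :: "(coord \<Rightarrow> 'c::finite) \<Rightarrow> nat \<Rightarrow> nat set set \<Rightarrow> real ^ 'c" where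
  "char_vector idx n \<pi> = (\<chi> k. char_component \<pi> (inv_into (coords n) idx k))"

definition partition_polytope :: "(coord \<Rightarrow> 'c::finite) \<Rightarrow> nat \<Rightarrow> nat \<Rightarrow> (real ^ 'c) set" where
  "partition_polytope idx n K = convex hull (char_vector idx n ` {\<pi>. K_partition n K \<pi>})"

definition full_dimensional :: "'a::euclidean_space set \<Rightarrow> bool" where
  "full_dimensional P \<longleftrightarrow> aff_dim P = int DIM('a)"

definition facet_defining :: "'a::euclidean_space set \<Rightarrow> ('a \<Rightarrow> real) \<Rightarrow> real \<Rightarrow> bool" where
  "facet_defining P f b \<longleftrightarrow>
     (\<forall>x\<in>P. f x \<le> b) \<and> aff_dim {x \<in> P. f x = b} = aff_dim P - 1"

definition edge_var :: "(coord \<Rightarrow> 'c::finite) \<Rightarrow> real ^ 'c \<Rightarrow> nat \<Rightarrow> nat \<Rightarrow> real" where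
  "edge_var idx x i j = x $ idx (Edge {i, j})"

definition two_partition_lhs ::
  "(coord \<Rightarrow> 'c::finite) \<Rightarrow> nat set \<Rightarrow> nat set \<Rightarrow> real ^ 'c \<Rightarrow> real" where
  "two_partition_lhs idx S T x =
     (\<Sum>s\<in>S. \<Sum>t\<in>T. edge_var idx x s t)
     - (\<Sum>(s, s') \<in> {(s, s'). s \<in> S \<and> s' \<in> S \<and> s < s'}. edge_var idx x s s')
     - (\<Sum>(t, t') \<in> {(t, t'). t \<in> T \<and> t' \<in> T \<and> t < t'}. edge_var idx x t t')"

end

theory Submission
  imports Defs
begin

text \<open>
  On a partition, a linear functional is the sum over the clusters \<open>C\<close> of a quadratic function
  of \<open>C\<close> (the edges) plus a function of \<open>Min C\<close> (the representatives). A partition satisfies the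
  2-partition inequality with equality iff every cluster contains as many elements of \<open>T\<close> as
  of \<open>S\<close>, or one more. The inequality defines a facet iff up to scaling it is the only equation
  satisfied by all these tight partitions.

  If one of the conditions fails, a second equation can be written down. Conversely, cut \<open>V\<close>
  into atoms \<open>{u}\<close>, \<open>{t}\<close> and \<open>{s, t}\<close>. Exchanging atoms between two clusters shows
  that the cluster function \<open>h\<close> of an equation satisfies \<open>h (A \<union> B) = h A + h B + q\<close> for
  a constant \<open>q\<close>, and that its third difference over three atoms is \<open>- q\<close>. Third differences
  annihilate quadratic functions, and what is left of the representative part is the coefficient of
  the largest of the three minima. By conditions (iii) and (iv), every vertex \<open>i \<ge> 3\<close> is such a
  largest minimum, so all these coefficients equal \<open>- q\<close>. As vertex 3 has no representative
  variable, \<open>q = 0\<close>, and the edge coefficients can be read off.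
\<close>

section \<open>Facets of a full-dimensional polytope as uniqueness of an equation\<close>

text \<open>The face where \<open>F\<close> attains \<open>b\<close> is the hull of the points of
  \<open>A\<close> on it, so an equation holds on the face iff it holds at those points. The face
  has codimension 1 iff its affine hull is the whole hyperplane, and then its only equations are
  multiples of \<open>F\<close>. The empty face has to be excluded separately, since in dimension 1
  every \<open>G\<close> is a multiple of \<open>F\<close>.\<close>

lemma facet_defining_convex_hull_iff:
  fixes F :: "'a::euclidean_space"
  assumes fin: "finite A" and full: "aff_dim (convex hull A) = int DIM('a)"
    and F: "F \<noteq> 0" and valid: "\<And>x. x \<in> A \<Longrightarrow> F \<bullet> x \<le> b"
  shows "facet_defining (convex hull A) (\<lambda>x. F \<bullet> x) b \<longleftrightarrow>
    (\<exists>x\<in>A. F \<bullet> x = b) \<and>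
    (\<forall>G d. (\<forall>x\<in>A. F \<bullet> x = b \<longrightarrow> G \<bullet> x = d) \<longrightarrow> (\<exists>\<gamma>. G = \<gamma> *\<^sub>R F))"
proof -
  have "convex hull A \<subseteq> {x. F \<bullet> x \<le> b}"
    by (rule hull_minimal) (use valid in \<open>auto simp: convex_halfspace_le\<close>)
  then have hull_valid: "\<And>x. x \<in> convex hull A \<Longrightarrow> F \<bullet> x \<le> b" by auto
  define T where "T = {x \<in> convex hull A. F \<bullet> x = b}"
  have T_Int: "T = convex hull A \<inter> {x. F \<bullet> x = b}" by (auto simp: T_def)
  have "T face_of convex hull A"
    unfolding T_Int using hull_valid by (intro face_of_Int_supporting_hyperplane_le) auto
  then obtain B where B: "B \<subseteq> A" "T = convex hull B"
    using face_of_convex_hull_subset finite_imp_compact[OF fin] by metis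
  have dimH: "aff_dim {x. F \<bullet> x = b} = int DIM('a) - 1"
    using aff_dim_hyperplane[OF F] by (simp add: of_nat_diff)
  have facet: "facet_defining (convex hull A) (\<lambda>x. F \<bullet> x) b \<longleftrightarrow> aff_dim T = int DIM('a) - 1"
    using hull_valid by (auto simp: facet_defining_def T_def full)
  show ?thesis unfolding facet
  proof (intro iffI conjI allI impI)
    assume dimT: "aff_dim T = int DIM('a) - 1"
    then have "T \<noteq> {}"
      using aff_dim_empty by (metis DIM_positive diff_gt_0_iff_gt of_nat_0_less_iff 
        add.left_neutral diff_add_cancel less_irrefl uminus_add_conv_diff)
    then obtain x0 where "x0 \<in> B" using B by fastforce
    then have x0: "x0 \<in> A" "F \<bullet> x0 = b" "x0 \<in> T"
      using B hull_subset[of B convex] by (auto simp: T_def)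
    then show "\<exists>x\<in>A. F \<bullet> x = b" by blast
    fix G d
    assume G: "\<forall>x\<in>A. F \<bullet> x = b \<longrightarrow> G \<bullet> x = d"
    have "B \<subseteq> T" using B hull_subset[of B convex] by simp
    then have "B \<subseteq> {x. G \<bullet> x = d}" using B G by (auto simp: T_def)
    then have "T \<subseteq> {x. G \<bullet> x = d}"
      unfolding B(2) by (intro hull_minimal) (auto simp: convex_hyperplane)
    then have "affine hull T \<subseteq> {x. G \<bullet> x = d}"
      by (intro hull_minimal) (auto simp: affine_hyperplane)
    moreover have "affine hull T = {x. F \<bullet> x = b}"
    proof (rule affine_dim_equal)
      show "affine hull T \<subseteq> {x. F \<bullet> x = b}"
        by (intro hull_minimal) (auto simp: affine_hyperplane T_def)
    qed (use \<open>T \<noteq> {}\<close> dimT dimH in \<open>auto simp: affine_hyperplane\<close>)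
    ultimately have sub: "{x. F \<bullet> x = b} \<subseteq> {x. G \<bullet> x = d}" by simp
    \<comment> \<open>\<open>v\<close> is the component of \<open>G\<close> orthogonal to
      \<open>F\<close>. Moving from \<open>x0\<close> along \<open>v\<close> stays in the hyperplane
      of \<open>F\<close>, where \<open>G\<close> is constant; so \<open>G\<close> is orthogonal to
      \<open>v\<close>, and so is \<open>F\<close>, which leaves \<open>v = 0\<close>.\<close>
    define v where "v = G - ((G \<bullet> F) / (F \<bullet> F)) *\<^sub>R F"
    have Fv: "F \<bullet> v = 0" using F by (simp add: v_def inner_diff_right inner_commute)
    then have "x0 + v \<in> {x. F \<bullet> x = b}" using x0 by (simp add: inner_add_right)
    then have "G \<bullet> (x0 + v) = d" using sub by blast
    then have "G \<bullet> v = 0" using x0 sub by (auto simp: inner_add_right)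
    then have "v \<bullet> v = 0" using Fv by (subst (1) v_def) (simp add: inner_diff_left)
    then show "\<exists>\<gamma>. G = \<gamma> *\<^sub>R F" by (auto simp: v_def)
  next
    assume asm: "(\<exists>x\<in>A. F \<bullet> x = b) \<and>
      (\<forall>G d. (\<forall>x\<in>A. F \<bullet> x = b \<longrightarrow> G \<bullet> x = d) \<longrightarrow> (\<exists>\<gamma>. G = \<gamma> *\<^sub>R F))"
    then obtain x0 where x0: "x0 \<in> A" "F \<bullet> x0 = b" by blast
    then have x0T: "x0 \<in> T" by (auto simp: T_def hull_inc)
    have "aff_dim T \<le> int DIM('a) - 1"
      using aff_dim_subset[of T "{x. F \<bullet> x = b}"] by (auto simp: dimH T_Int)
    moreover have False if less: "aff_dim T < int DIM('a) - 1"
    proof -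
      \<comment> \<open>\<open>p\<close> lies off the hyperplane. If the face were too small, some
        hyperplane would contain the face together with \<open>p\<close>; its normal is a multiple
        of \<open>F\<close> by assumption, which would put \<open>p\<close> on the hyperplane of
        \<open>F\<close>.\<close>
      define p where "p = x0 + F"
      have p: "F \<bullet> p \<noteq> b" using x0 F by (simp add: p_def inner_add_right)
      have "aff_dim (insert p T) < int DIM('a)"
        using less by (simp add: aff_dim_insert)
      then obtain G d where G: "G \<noteq> 0" "insert p T \<subseteq> {x. G \<bullet> x = d}"
        by (metis aff_lowdim_subset_hyperplane)
      moreover have "\<And>x. x \<in> A \<Longrightarrow> F \<bullet> x = b \<Longrightarrow> x \<in> T" by (simp add: T_def hull_inc)
      ultimately have "\<forall>x\<in>A. F \<bullet> x = b \<longrightarrow> G \<bullet> x = d" by blast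
      then obtain \<gamma> where \<gamma>: "G = \<gamma> *\<^sub>R F" using asm by blast
      have "G \<bullet> p = G \<bullet> x0" using G x0T by auto
      then show False using \<gamma> G(1) p x0 by auto
    qed
    ultimately show "aff_dim T = int DIM('a) - 1" by force
  qed
qed

subsection \<open>Linear functionals as cluster weights\<close>

text \<open>Edges are summed over ordered pairs and halved, which makes the edge part a symmetric
  bilinear form that splits over disjoint unions. Vertices 1, 2, 3 have no representative variable,
  hence the guard \<open>4 \<le> Min C\<close>.\<close>

definition cluster_weight :: "(coord \<Rightarrow> real) \<Rightarrow> nat set \<Rightarrow> real" where
  "cluster_weight g C =
     (\<Sum>i\<in>C. \<Sum>j\<in>C. if i = j then 0 else g (Edge {i, j})) / 2
     + (if 4 \<le> Min C then g (Rep (Min C)) else 0)"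

lemma sum_ordered_pairs:
  fixes f :: "nat set \<Rightarrow> real"
  assumes "finite V"
  shows "(\<Sum>(i, j)\<in>{(i, j). i \<in> V \<and> j \<in> V \<and> i < j}. f {i, j})
    = (\<Sum>i\<in>V. \<Sum>j\<in>V. if i = j then 0 else f {i, j}) / 2"
proof -
  let ?L = "{(i, j). i \<in> V \<and> j \<in> V \<and> i < j}"
  let ?R = "{(i, j). i \<in> V \<and> j \<in> V \<and> j < i}"
  have fin: "finite ?L" "finite ?R"
    by (rule finite_subset[of _ "V \<times> V"]; use assms in auto)+
  have "(\<Sum>i\<in>V. \<Sum>j\<in>V. if i = j then 0 else f {i, j})
      = (\<Sum>(i, j)\<in>V \<times> V. if i = j then 0 else f {i, j})"
    by (simp add: sum.cartesian_product)
  also have "\<dots> = (\<Sum>(i, j)\<in>?L \<union> ?R. f {i, j})"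
    by (rule sum.mono_neutral_cong_right) (use assms in \<open>auto split: if_splits\<close>)
  also have "\<dots> = (\<Sum>(i, j)\<in>?L. f {i, j}) + (\<Sum>(i, j)\<in>?R. f {i, j})"
    by (rule sum.union_disjoint) (use fin in auto)
  also have "(\<Sum>(i, j)\<in>?R. f {i, j}) = (\<Sum>(i, j)\<in>?L. f {i, j})"
    by (rule sum.reindex_bij_witness[where i="\<lambda>(i, j). (j, i)" and j="\<lambda>(i, j). (j, i)"])
      (auto simp: insert_commute)
  finally show ?thesis by simp
qed

lemma sum_edges:
  fixes f :: "nat set \<Rightarrow> real"
  assumes "finite V"
  shows "(\<Sum>e\<in>{{i, j} | i j. i \<in> V \<and> j \<in> V \<and> i \<noteq> j}. f e)
    = (\<Sum>i\<in>V. \<Sum>j\<in>V. if i = j then 0 else f {i, j}) / 2"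
proof -
  let ?L = "{(i, j). i \<in> V \<and> j \<in> V \<and> i < j}"
  have "{{i, j} | i j. i \<in> V \<and> j \<in> V \<and> i \<noteq> j} = (\<lambda>(i, j). {i, j}) ` ?L" (is "?E = _")
  proof (intro equalityI subsetI)
    fix e assume "e \<in> ?E"
    then obtain i j where "e = {i, j}" "i \<in> V" "j \<in> V" "i \<noteq> j" by blast
    then have "(i < j \<and> (i, j) \<in> ?L \<and> e = {i, j}) \<or> (j < i \<and> (j, i) \<in> ?L \<and> e = {j, i})" by auto
    then show "e \<in> (\<lambda>(i, j). {i, j}) ` ?L" by (metis (mono_tags, lifting) case_prod_conv image_iff)
  next
    fix e assume "e \<in> (\<lambda>(i, j). {i, j}) ` ?L"
    then show "e \<in> ?E" by force
  qed
  moreover have "inj_on (\<lambda>(i, j). {i, j}) ?L"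
    by (auto simp: inj_on_def doubleton_eq_iff)
  ultimately have "(\<Sum>e\<in>?E. f e) = (\<Sum>(i, j)\<in>?L. f {i, j})"
    by (simp add: sum.reindex case_prod_unfold)
  then show ?thesis using sum_ordered_pairs[OF assms] by simp
qed

lemma sum_coords:
  fixes f :: "coord \<Rightarrow> real"
  shows "(\<Sum>y\<in>coords n. f y) =
    (\<Sum>i\<in>{1..n}. \<Sum>j\<in>{1..n}. if i = j then 0 else f (Edge {i, j})) / 2
    + (\<Sum>u\<in>{4..n}. f (Rep u))"
proof -
  let ?E = "{{i, j} | i j. i \<in> {1..n} \<and> j \<in> {1..n} \<and> i \<noteq> j}"
  have "finite ?E" by (rule finite_subset[of _ "Pow {1..n}"]) auto
  then have "(\<Sum>y\<in>coords n. f y) = (\<Sum>y\<in>Edge ` ?E. f y) + (\<Sum>y\<in>Rep ` {4..n}. f y)"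
    unfolding coords_def by (intro sum.union_disjoint) auto
  also have "(\<Sum>y\<in>Edge ` ?E. f y) = (\<Sum>e\<in>?E. f (Edge e))"
    by (simp add: sum.reindex inj_on_def)
  also have "\<dots> = (\<Sum>i\<in>{1..n}. \<Sum>j\<in>{1..n}. if i = j then 0 else f (Edge {i, j})) / 2"
    by (rule sum_edges) simp
  finally show ?thesis by (simp add: sum.reindex inj_on_def)
qed

lemma inner_eq_sum_coords:
  fixes w x :: "real ^ 'c::finite"
  assumes "bij_betw idx (coords n) (UNIV :: 'c set)"
  shows "w \<bullet> x = (\<Sum>y\<in>coords n. w $ idx y * x $ idx y)"
  unfolding inner_vec_def using sum.reindex_bij_betw[OF assms, of "\<lambda>k. w $ k * x $ k"] by simp

lemma char_vector_nth:
  assumes "bij_betw idx (coords n) (UNIV :: 'c::finite set)" "y \<in> coords n"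
  shows "char_vector idx n \<pi> $ idx y = char_component \<pi> y"
  using assms by (simp add: char_vector_def bij_betw_def inv_into_f_f)

lemma K_partitionD:
  assumes "K_partition n K \<pi>"
  shows "\<Union>\<pi> = {1..n}" "finite \<pi>" "card \<pi> = K"
    and "\<And>C. C \<in> \<pi> \<Longrightarrow> C \<subseteq> {1..n} \<and> finite C \<and> C \<noteq> {}"
    and "\<And>C D x. C \<in> \<pi> \<Longrightarrow> D \<in> \<pi> \<Longrightarrow> x \<in> C \<Longrightarrow> x \<in> D \<Longrightarrow> C = D"
proof -
  have p: "partition_on {1..n} \<pi>" and c: "card \<pi> = K" using assms by (auto simp: K_partition_def)
  show U: "\<Union>\<pi> = {1..n}" using partition_onD1[OF p] by simp
  show "finite \<pi>" using finite_UnionD[of \<pi>] U by simp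
  show "card \<pi> = K" by (rule c)
  show "C \<subseteq> {1..n} \<and> finite C \<and> C \<noteq> {}" if "C \<in> \<pi>" for C
  proof -
    have "C \<subseteq> {1..n}" using that U by auto
    then show ?thesis using that partition_onD3[OF p] finite_subset by auto
  qed
  show "C = D" if "C \<in> \<pi>" "D \<in> \<pi>" "x \<in> C" "x \<in> D" for C D x
    using partition_onD2[OF p] that unfolding disjoint_def by blast
qed

lemma sum_K_partition:
  fixes f :: "nat \<Rightarrow> 'b::comm_monoid_add"
  assumes "K_partition n K \<pi>"
  shows "(\<Sum>i\<in>{1..n}. f i) = (\<Sum>C\<in>\<pi>. \<Sum>i\<in>C. f i)"
proof -
  note p = K_partitionD[OF assms]
  have "sum f (\<Union>\<pi>) = (\<Sum>C\<in>\<pi>. sum f C)"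
    using p(4,5) by (subst sum.Union_disjoint) auto
  then show ?thesis by (simp add: p(1))
qed

text \<open>A vertex \<open>j\<close> is joined to \<open>i\<close> exactly when it lies in the
  cluster of \<open>i\<close>, so the edge sum splits by clusters. For the representatives,
  \<open>Min\<close> is injective on the clusters, as these are disjoint.\<close>

lemma inner_char_vector:
  fixes w :: "real ^ 'c::finite"
  assumes idx: "bij_betw idx (coords n) (UNIV :: 'c set)" and \<pi>: "K_partition n K \<pi>"
  shows "w \<bullet> char_vector idx n \<pi> = (\<Sum>C\<in>\<pi>. cluster_weight (\<lambda>y. w $ idx y) C)"
proof -
  note p = K_partitionD[OF \<pi>]
  define g where "g = (\<lambda>y. w $ idx y)"
  have "w \<bullet> char_vector idx n \<pi> = (\<Sum>y\<in>coords n. g y * char_component \<pi> y)"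
    unfolding inner_eq_sum_coords[OF idx] g_def
    by (intro sum.cong refl) (simp add: char_vector_nth[OF idx])
  also have "\<dots> = (\<Sum>i\<in>{1..n}. \<Sum>j\<in>{1..n}. if i = j then 0
        else g (Edge {i, j}) * char_component \<pi> (Edge {i, j})) / 2
      + (\<Sum>u\<in>{4..n}. g (Rep u) * char_component \<pi> (Rep u))"
    by (rule sum_coords)
  also have "(\<Sum>i\<in>{1..n}. \<Sum>j\<in>{1..n}. if i = j then 0
        else g (Edge {i, j}) * char_component \<pi> (Edge {i, j}))
      = (\<Sum>C\<in>\<pi>. \<Sum>i\<in>C. \<Sum>j\<in>C. if i = j then 0 else g (Edge {i, j}))"
  proof (subst sum_K_partition[OF \<pi>], rule sum.cong[OF refl], rule sum.cong[OF refl])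
    fix C i assume C: "C \<in> \<pi>" "i \<in> C"
    have iff: "(\<exists>D\<in>\<pi>. {i, j} \<subseteq> D) \<longleftrightarrow> j \<in> C" for j
      using C p(5) by auto
    show "(\<Sum>j\<in>{1..n}. if i = j then 0 else g (Edge {i, j}) * char_component \<pi> (Edge {i, j}))
        = (\<Sum>j\<in>C. if i = j then 0 else g (Edge {i, j}))"
    proof (rule sum.mono_neutral_cong_right)
      show "C \<subseteq> {1..n}" using C p(4) by blast
    qed (auto simp: iff simp del: insert_subset)
  qed
  also have "(\<Sum>u\<in>{4..n}. g (Rep u) * char_component \<pi> (Rep u))
      = (\<Sum>C\<in>\<pi>. if 4 \<le> Min C then g (Rep (Min C)) else 0)"
  proof -
    have Min_in: "Min C \<in> C" if "C \<in> \<pi>" for C using p(4)[OF that] by simp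
    have inj: "inj_on Min \<pi>" using Min_in p(5) by (metis inj_onI)
    have "(\<Sum>C\<in>\<pi>. if 4 \<le> Min C then g (Rep (Min C)) else 0)
        = (\<Sum>u\<in>Min ` \<pi>. if 4 \<le> u then g (Rep u) else 0)"
      by (simp add: sum.reindex[OF inj])
    also have "\<dots> = (\<Sum>u\<in>Min ` \<pi> \<inter> {4..n}. g (Rep u))"
    proof (rule sum.mono_neutral_cong_right)
      show "\<forall>i\<in>Min ` \<pi> - Min ` \<pi> \<inter> {4..n}. (if 4 \<le> i then g (Rep i) else 0) = 0"
        using Min_in p(4) by fastforce
    qed (use p(2) in auto)
    also have "\<dots> = (\<Sum>u\<in>{4..n}. g (Rep u) * char_component \<pi> (Rep u))"
    proof (rule sum.mono_neutral_cong_left)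
      show "\<forall>i\<in>{4..n} - Min ` \<pi> \<inter> {4..n}. g (Rep i) * char_component \<pi> (Rep i) = 0"
        by auto
      show "\<And>x. x \<in> Min ` \<pi> \<inter> {4..n} \<Longrightarrow> g (Rep x) = g (Rep x) * char_component \<pi> (Rep x)"
        using Min_in by auto
    qed auto
    finally show ?thesis by simp
  qed
  finally show ?thesis
    by (simp only: cluster_weight_def sum.distrib sum_divide_distrib[symmetric] g_def)
qed

lemma Edge_in_coords: "i \<in> {1..n} \<Longrightarrow> j \<in> {1..n} \<Longrightarrow> i \<noteq> j \<Longrightarrow> Edge {i, j} \<in> coords n"
  unfolding coords_def by blast

lemma Rep_in_coords: "u \<in> {4..n} \<Longrightarrow> Rep u \<in> coords n"
  unfolding coords_def by blast

lemma coords_cases: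
  assumes "y \<in> coords n"
  obtains i j where "y = Edge {i, j}" "i \<in> {1..n}" "j \<in> {1..n}" "i \<noteq> j"
  | u where "y = Rep u" "u \<in> {4..n}"
  using assms unfolding coords_def by blast

lemma cluster_weight_cong:
  assumes C: "C \<subseteq> {1..n}" "C \<noteq> {}" and eq: "\<And>y. y \<in> coords n \<Longrightarrow> f y = g y"
  shows "cluster_weight f C = cluster_weight g C"
proof -
  have "finite C" using C(1) finite_subset by auto
  then have "Min C \<in> {1..n}" using C Min_in by blast
  then have "f (Rep (Min C)) = g (Rep (Min C))" if "4 \<le> Min C"
    using that by (simp add: eq Rep_in_coords)
  moreover have "(if i = j then 0 else f (Edge {i, j})) = (if i = j then 0 else g (Edge {i, j}))"
    if "i \<in> C" "j \<in> C" for i j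
    using subsetD[OF C(1) that(1)] subsetD[OF C(1) that(2)] by (simp add: eq Edge_in_coords)
  ultimately show ?thesis by (simp add: cluster_weight_def cong: sum.cong)
qed

subsection \<open>Tight partitions\<close>

definition side_sign :: "nat set \<Rightarrow> nat set \<Rightarrow> nat \<Rightarrow> real" where
  "side_sign S T i = (if i \<in> S then 1 else if i \<in> T then - 1 else 0)"

text \<open>The product of signs gives all three sums of the inequality at once: coefficient 1
  between \<open>S\<close> and \<open>T\<close>, -1 inside either set, and 0 as soon as a vertex
  outside \<open>S \<union> T\<close> is involved.\<close>

fun two_partition_coeff :: "nat set \<Rightarrow> nat set \<Rightarrow> coord \<Rightarrow> real" where
  "two_partition_coeff S T (Edge e) = - (\<Prod>i\<in>e. side_sign S T i)"
| "two_partition_coeff S T (Rep u) = 0"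

definition excess :: "nat set \<Rightarrow> nat set \<Rightarrow> nat set \<Rightarrow> int" where
  "excess S T C = int (card (T \<inter> C)) - int (card (S \<inter> C))"

lemma sum_of_bool_mem:
  assumes "finite C"
  shows "(\<Sum>i\<in>C. of_bool (i \<in> A)) = (of_nat (card (A \<inter> C)) :: 'a::semiring_1)"
proof -
  have "(\<Sum>i\<in>C. of_bool (i \<in> A)) = (\<Sum>i\<in>A \<inter> C. 1 :: 'a)"
    by (rule sum.mono_neutral_cong_right) (use assms in auto)
  then show ?thesis by simp
qed

lemma sum_side_sign:
  assumes "finite C" "S \<inter> T = {}"
  shows "(\<Sum>i\<in>C. side_sign S T i) = - of_int (excess S T C)"
proof -
  have "side_sign S T i = of_bool (i \<in> S) - of_bool (i \<in> T)" for i
    using assms(2) by (auto simp: side_sign_def)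
  then show ?thesis
    by (simp add: sum_subtractf sum_of_bool_mem[OF assms(1)] excess_def)
qed

lemma sum_side_sign_square:
  assumes "finite C" "S \<inter> T = {}"
  shows "(\<Sum>i\<in>C. side_sign S T i * side_sign S T i)
    = real (card (S \<inter> C)) + real (card (T \<inter> C))"
proof -
  have "side_sign S T i * side_sign S T i = of_bool (i \<in> S) + of_bool (i \<in> T)" for i
    using assms(2) by (auto simp: side_sign_def)
  then show ?thesis
    by (simp only: sum.distrib sum_of_bool_mem[OF assms(1)])
qed

text \<open>The products of signs over ordered pairs of distinct vertices add up to the square of
  the sum of signs minus the sum of their squares. With \<open>e\<close> for the excess, the weight
  is \<open>(card (S \<inter> C) + card (T \<inter> C) - e^2) / 2\<close>, and
  \<open>card (T \<inter> C) = card (S \<inter> C) + e\<close>.\<close>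

lemma cluster_weight_two_partition:
  assumes "finite C" "S \<inter> T = {}"
  shows "cluster_weight (two_partition_coeff S T) C
    = real (card (S \<inter> C)) + of_int (excess S T C - (excess S T C)\<^sup>2) / 2"
proof -
  let ?\<sigma> = "side_sign S T"
  have "(\<Sum>i\<in>C. \<Sum>j\<in>C. if i = j then 0 else two_partition_coeff S T (Edge {i, j}))
      = (\<Sum>i\<in>C. \<Sum>j\<in>C. (if i = j then ?\<sigma> i * ?\<sigma> i else 0) - ?\<sigma> i * ?\<sigma> j)"
    by (intro sum.cong refl) auto
  also have "\<dots> = (\<Sum>i\<in>C. ?\<sigma> i * ?\<sigma> i) - (\<Sum>i\<in>C. ?\<sigma> i) * (\<Sum>i\<in>C. ?\<sigma> i)"
    using assms(1) by (simp add: sum_subtractf sum_product sum.delta)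
  also have "\<dots> = real (card (S \<inter> C)) + real (card (T \<inter> C)) - (of_int (excess S T C))\<^sup>2"
    by (simp add: sum_side_sign[OF assms] sum_side_sign_square[OF assms] power2_eq_square)
  finally show ?thesis
    by (simp add: cluster_weight_def) (simp add: excess_def field_simps)
qed

lemma two_partition_lhs_eq_inner:
  fixes x :: "real ^ 'c::finite"
  assumes idx: "bij_betw idx (coords n) (UNIV :: 'c set)"
    and S: "S \<subseteq> {1..n}" and T: "T \<subseteq> {1..n}" and disj: "S \<inter> T = {}"
  shows "two_partition_lhs idx S T x
    = (\<chi> k. two_partition_coeff S T (inv_into (coords n) idx k)) \<bullet> x"
proof -
  define X where "X e = x $ idx (Edge e)" for e
  define f where "f i j = (if i = j then 0 else - (side_sign S T i * side_sign S T j) * X {i, j})" for i j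
  have fin: "finite S" "finite T" using S T finite_subset by auto
  have "(\<chi> k. two_partition_coeff S T (inv_into (coords n) idx k)) \<bullet> x
      = (\<Sum>y\<in>coords n. two_partition_coeff S T y * x $ idx y)"
    unfolding inner_eq_sum_coords[OF idx]
    using idx by (intro sum.cong refl) (simp add: bij_betw_def inv_into_f_f)
  also have "\<dots> = (\<Sum>i\<in>{1..n}. \<Sum>j\<in>{1..n}. f i j) / 2"
    unfolding sum_coords
    by (simp add: f_def X_def cong: if_cong)
  also have "(\<Sum>i\<in>{1..n}. \<Sum>j\<in>{1..n}. f i j) = (\<Sum>i\<in>S \<union> T. \<Sum>j\<in>S \<union> T. f i j)"
  proof (rule sum.mono_neutral_cong_right)
    show "\<forall>i\<in>{1..n} - (S \<union> T). (\<Sum>j\<in>{1..n}. f i j) = 0"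
      by (auto simp: f_def side_sign_def intro!: sum.neutral)
    show "(\<Sum>j\<in>{1..n}. f i j) = (\<Sum>j\<in>S \<union> T. f i j)" for i
      by (rule sum.mono_neutral_right) (use S T in \<open>auto simp: f_def side_sign_def\<close>)
  qed (use S T in auto)
  \<comment> \<open>Of the four blocks, the two mixed ones agree, which cancels the factor 1/2; the
    other two are sums over ordered pairs, twice the sums over \<open>s < s'\<close> and
    \<open>t < t'\<close>.\<close>
  also have "\<dots> = (\<Sum>i\<in>S. \<Sum>j\<in>S. f i j) + (\<Sum>i\<in>S. \<Sum>j\<in>T. f i j)
      + ((\<Sum>i\<in>T. \<Sum>j\<in>S. f i j) + (\<Sum>i\<in>T. \<Sum>j\<in>T. f i j))"
    using fin disj by (simp add: sum.union_disjoint sum.distrib)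
  also have "(\<Sum>i\<in>T. \<Sum>j\<in>S. f i j) = (\<Sum>i\<in>S. \<Sum>j\<in>T. f i j)"
    by (subst sum.swap) (auto simp: f_def insert_commute mult.commute intro!: sum.cong)
  also have "(\<Sum>i\<in>S. \<Sum>j\<in>T. f i j) = (\<Sum>s\<in>S. \<Sum>t\<in>T. X {s, t})"
    by (intro sum.cong refl) (use disj in \<open>auto simp: f_def side_sign_def\<close>)
  also have "(\<Sum>i\<in>S. \<Sum>j\<in>S. f i j) = - (\<Sum>i\<in>S. \<Sum>j\<in>S. if i = j then 0 else X {i, j})"
    unfolding sum_negf[symmetric]
    by (intro sum.cong refl) (auto simp: f_def side_sign_def)
  also have "(\<Sum>i\<in>T. \<Sum>j\<in>T. f i j) = - (\<Sum>i\<in>T. \<Sum>j\<in>T. if i = j then 0 else X {i, j})"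
    unfolding sum_negf[symmetric]
    by (intro sum.cong refl) (use disj in \<open>auto simp: f_def side_sign_def\<close>)
  finally show ?thesis
    unfolding two_partition_lhs_def edge_var_def X_def[symmetric]
      sum_ordered_pairs[OF fin(1), of X] sum_ordered_pairs[OF fin(2), of X]
    by (simp add: field_simps)
qed

lemma sum_card_Int_K_partition:
  assumes "K_partition n K \<pi>" "A \<subseteq> {1..n}"
  shows "(\<Sum>C\<in>\<pi>. card (A \<inter> C)) = card A"
proof -
  note p = K_partitionD[OF assms(1)]
  have "card A = (\<Sum>i\<in>{1..n}. of_bool (i \<in> A))"
    using sum_of_bool_mem[of "{1..n}" A, where 'a=nat] assms(2) by (simp add: Int_absorb2)
  also have "\<dots> = (\<Sum>C\<in>\<pi>. \<Sum>i\<in>C. of_bool (i \<in> A))"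
    by (rule sum_K_partition[OF assms(1)])
  also have "\<dots> = (\<Sum>C\<in>\<pi>. card (A \<inter> C))"
    using p(4) by (intro sum.cong refl) (simp add: Int_commute)
  finally show ?thesis by simp
qed

lemma diff_square_nonpos: "(k::int) - k\<^sup>2 \<le> 0"
proof -
  have "k \<le> k\<^sup>2"
  proof (cases "k \<le> 0")
    case False
    then show ?thesis using mult_left_mono[of 1 k k] by (simp add: power2_eq_square)
  qed (use order_trans zero_le_power2 in blast)
  then show ?thesis by simp
qed

locale vertex_pair =
  fixes n :: nat and S T :: "nat set"
  assumes S: "S \<subseteq> {1..n}" "S \<noteq> {}"
    and T: "T \<subseteq> {1..n}" "T \<noteq> {}"
    and disj: "S \<inter> T = {}"
begin

abbreviation balanced :: "nat set \<Rightarrow> bool" where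
  "balanced C \<equiv> excess S T C \<in> {0, 1}"

definition tight :: "nat \<Rightarrow> nat set set \<Rightarrow> bool" where
  "tight K \<pi> \<longleftrightarrow> K_partition n K \<pi> \<and> (\<forall>C\<in>\<pi>. balanced C)"

lemma finite_ST: "finite S" "finite T"
  using S T finite_subset by auto

lemma card_S_pos: "1 \<le> card S"
  using S finite_ST by (simp add: Suc_leI card_gt_0_iff)

lemma S_neq_T: "s \<in> S \<Longrightarrow> t \<in> T \<Longrightarrow> s \<noteq> t"
  using disj by blast

lemma two_partition_lhs_char_vector:
  assumes "bij_betw idx (coords n) (UNIV :: 'c::finite set)" and \<pi>: "K_partition n K \<pi>"
  shows "two_partition_lhs idx S T (char_vector idx n \<pi>)
    = real (card S) + (\<Sum>C\<in>\<pi>. of_int (excess S T C - (excess S T C)\<^sup>2)) / 2"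
proof -
  note p = K_partitionD[OF \<pi>]
  have "two_partition_lhs idx S T (char_vector idx n \<pi>)
      = (\<Sum>C\<in>\<pi>. cluster_weight (two_partition_coeff S T) C)"
    unfolding two_partition_lhs_eq_inner[OF assms(1) S(1) T(1) disj] inner_char_vector[OF assms]
    using p(4) assms(1)
    by (intro sum.cong refl cluster_weight_cong[of _ n]) (auto simp: bij_betw_def inv_into_f_f)
  also have "\<dots> = (\<Sum>C\<in>\<pi>. real (card (S \<inter> C))
      + of_int (excess S T C - (excess S T C)\<^sup>2) / 2)"
    using p(4) disj by (intro sum.cong refl cluster_weight_two_partition) auto
  also have "\<dots> = real (\<Sum>C\<in>\<pi>. card (S \<inter> C))
      + (\<Sum>C\<in>\<pi>. of_int (excess S T C - (excess S T C)\<^sup>2)) / 2"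
    by (simp add: sum.distrib sum_divide_distrib)
  finally show ?thesis by (simp only: sum_card_Int_K_partition[OF \<pi> S(1)])
qed

text \<open>Each cluster contributes \<open>e * (1 - e) / 2\<close> beyond its share of
  \<open>card S\<close>, where \<open>e\<close> is its excess. This is never positive for an integer
  \<open>e\<close> and vanishes only for \<open>e = 0\<close> and \<open>e = 1\<close>, so equality
  forces every cluster to be balanced.\<close>

lemma two_partition_valid:
  assumes "bij_betw idx (coords n) (UNIV :: 'c::finite set)" and \<pi>: "K_partition n K \<pi>"
  shows "two_partition_lhs idx S T (char_vector idx n \<pi>) \<le> real (card S)"
    and "two_partition_lhs idx S T (char_vector idx n \<pi>) = real (card S) \<longleftrightarrow> tight K \<pi>"
proof -
  have nonpos: "(of_int (excess S T C - (excess S T C)\<^sup>2) :: real) \<le> 0" for C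
    using diff_square_nonpos by (subst of_int_le_0_iff)
  then have "(\<Sum>C\<in>\<pi>. of_int (excess S T C - (excess S T C)\<^sup>2)) \<le> (0::real)"
    by (rule sum_nonpos)
  then show "two_partition_lhs idx S T (char_vector idx n \<pi>) \<le> real (card S)"
    by (simp only: two_partition_lhs_char_vector[OF assms])
  have "(\<Sum>C\<in>\<pi>. of_int (excess S T C - (excess S T C)\<^sup>2)) = (0::real) \<longleftrightarrow>
      (\<forall>C\<in>\<pi>. of_int (excess S T C - (excess S T C)\<^sup>2) = (0::real))"
    using sum_nonneg_eq_0_iff[OF K_partitionD(2)[OF \<pi>],
        of "\<lambda>C. - of_int (excess S T C - (excess S T C)\<^sup>2) :: real"] nonpos
    by (simp only: sum_negf neg_equal_0_iff_equal neg_0_le_iff_le)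
  also have "\<dots> \<longleftrightarrow> (\<forall>C\<in>\<pi>. balanced C)"
  proof (intro ball_cong refl)
    fix C
    have "(of_int (excess S T C - (excess S T C)\<^sup>2) = (0::real))
        \<longleftrightarrow> excess S T C * (1 - excess S T C) = 0"
      by (simp only: of_int_eq_0_iff) (simp add: power2_eq_square algebra_simps)
    then show "(of_int (excess S T C - (excess S T C)\<^sup>2) = (0::real)) \<longleftrightarrow> balanced C"
      by auto
  qed
  finally show "two_partition_lhs idx S T (char_vector idx n \<pi>) = real (card S) \<longleftrightarrow> tight K \<pi>"
    using \<pi> by (simp add: two_partition_lhs_char_vector[OF assms] tight_def)
qed

end

section \<open>Equations on partitions in place of faces of the polytope\<close>

lemma finite_K_partitions: "finite {\<pi>. K_partition n K \<pi>}"
proof (rule finite_subset)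
  show "{\<pi>. K_partition n K \<pi>} \<subseteq> Pow (Pow {1..n})"
    using K_partitionD(4) by blast
qed simp

lemma inner_chi_char_vector:
  assumes idx: "bij_betw idx (coords n) (UNIV :: 'c::finite set)" and \<pi>: "K_partition n K \<pi>"
  shows "(\<chi> k. g (inv_into (coords n) idx k)) \<bullet> char_vector idx n \<pi>
    = (\<Sum>C\<in>\<pi>. cluster_weight g C)"
  unfolding inner_char_vector[OF assms]
  using K_partitionD(4)[OF \<pi>] idx
  by (intro sum.cong refl cluster_weight_cong[of _ n]) (auto simp: bij_betw_def inv_into_f_f)

text \<open>A nontrivial equation shared by all partitions would put the polytope into a hyperplane.
  This is how full dimension is turned into bounds on \<open>K\<close>.\<close>

lemma full_dimensional_no_equation:
  assumes idx: "bij_betw idx (coords n) (UNIV :: 'c::finite set)"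
    and full: "full_dimensional (partition_polytope idx n K)"
    and eq: "\<And>\<pi>. K_partition n K \<pi> \<Longrightarrow> (\<Sum>C\<in>\<pi>. cluster_weight g C) = d"
    and y: "y \<in> coords n"
  shows "g y = 0"
proof -
  define G where "G = (\<chi> k. g (inv_into (coords n) idx k))"
  have "partition_polytope idx n K \<subseteq> {x. G \<bullet> x = d}"
    unfolding partition_polytope_def G_def
    by (rule hull_minimal) (auto simp: convex_hyperplane inner_chi_char_vector[OF idx] eq)
  then have "aff_dim (partition_polytope idx n K) \<le> aff_dim {x. G \<bullet> x = d}"
    by (rule aff_dim_subset)
  then have "\<not> G \<noteq> 0"
    using full aff_dim_hyperplane[of G d] unfolding full_dimensional_def by fastforce
  then have "G $ idx y = 0" by simp
  then show ?thesis using idx y by (simp add: G_def bij_betw_def inv_into_f_f)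
qed

context vertex_pair
begin

text \<open>This moves the convex hull criterion from normal vectors to coefficient functions on
  \<open>coords n\<close>, so that only partitions and cluster weights matter from here on. The
  normal vector is nonzero because an edge between \<open>S\<close> and \<open>T\<close> has
  coefficient 1.\<close>

lemma facet_iff_unique_equation:
  assumes idx: "bij_betw idx (coords n) (UNIV :: 'c::finite set)"
    and full: "full_dimensional (partition_polytope idx n K)"
  shows "facet_defining (partition_polytope idx n K) (two_partition_lhs idx S T) (real (card S))
    \<longleftrightarrow> (\<exists>\<pi>. tight K \<pi>) \<and>
      (\<forall>g d. (\<forall>\<pi>. tight K \<pi> \<longrightarrow> (\<Sum>C\<in>\<pi>. cluster_weight g C) = d)
        \<longrightarrow> (\<exists>\<gamma>. \<forall>y\<in>coords n. g y = \<gamma> * two_partition_coeff S T y))"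
proof -
  let ?A = "char_vector idx n ` {\<pi>. K_partition n K \<pi>}"
  let ?vec = "\<lambda>g. \<chi> k. g (inv_into (coords n) idx k)"
  let ?F = "?vec (two_partition_coeff S T)"
  have lhs: "two_partition_lhs idx S T = (\<lambda>x. ?F \<bullet> x)"
    using two_partition_lhs_eq_inner[OF idx S(1) T(1) disj] by blast
  have nth: "?vec g $ idx y = g y" if "y \<in> coords n" for g y
    using idx that by (simp add: bij_betw_def inv_into_f_f)
  have inv: "inv_into (coords n) idx k \<in> coords n" "idx (inv_into (coords n) idx k) = k" for k
    using idx by (metis UNIV_I bij_betw_def f_inv_into_f inv_into_into)+
  have multiple_iff: "(\<exists>\<gamma>. ?vec g = \<gamma> *\<^sub>R ?F)
      \<longleftrightarrow> (\<exists>\<gamma>. \<forall>y\<in>coords n. g y = \<gamma> * two_partition_coeff S T y)" for g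
  proof (intro iffI; elim exE)
    fix \<gamma> assume eq: "?vec g = \<gamma> *\<^sub>R ?F"
    have "g y = \<gamma> * two_partition_coeff S T y" if "y \<in> coords n" for y
    proof -
      have "?vec g $ idx y = \<gamma> * ?F $ idx y" by (simp only: eq vector_scaleR_component real_scaleR_def)
      then show ?thesis by (simp only: nth[OF that])
    qed
    then show "\<exists>\<gamma>. \<forall>y\<in>coords n. g y = \<gamma> * two_partition_coeff S T y" by blast
  next
    fix \<gamma> assume "\<forall>y\<in>coords n. g y = \<gamma> * two_partition_coeff S T y"
    then have "?vec g = \<gamma> *\<^sub>R ?F" using inv by (simp add: vec_eq_iff)
    then show "\<exists>\<gamma>. ?vec g = \<gamma> *\<^sub>R ?F" by blast
  qed
  obtain s t where st: "s \<in> S" "t \<in> T" using S T by blast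
  then have st': "s \<noteq> t" "s \<notin> T" "t \<notin> S" using disj by auto
  then have "Edge {s, t} \<in> coords n" using st S T by (intro Edge_in_coords) auto
  then have "?F $ idx (Edge {s, t}) = 1"
    using st st' by (simp add: side_sign_def nth del: vec_lambda_beta)
  then have F: "?F \<noteq> 0" by (metis zero_index zero_neq_one)
  have surj: "\<exists>g. G = ?vec g" for G :: "real ^ 'c"
    using inv by (intro exI[of _ "\<lambda>y. G $ idx y"]) (simp add: vec_eq_iff)
  have "facet_defining (partition_polytope idx n K) (two_partition_lhs idx S T) (real (card S))
    \<longleftrightarrow> (\<exists>x\<in>?A. ?F \<bullet> x = real (card S)) \<and>
      (\<forall>G d. (\<forall>x\<in>?A. ?F \<bullet> x = real (card S) \<longrightarrow> G \<bullet> x = d) \<longrightarrow> (\<exists>\<gamma>. G = \<gamma> *\<^sub>R ?F))"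
    unfolding lhs partition_polytope_def
  proof (rule facet_defining_convex_hull_iff[OF _ _ F])
    show "aff_dim (convex hull ?A) = int DIM(real ^ 'c)"
      using full by (simp add: full_dimensional_def partition_polytope_def)
  qed (use finite_K_partitions two_partition_valid(1)[OF idx] lhs in auto)
  also have "\<dots> \<longleftrightarrow> (\<exists>\<pi>. tight K \<pi>) \<and>
      (\<forall>G d. (\<forall>\<pi>. tight K \<pi> \<longrightarrow> G \<bullet> char_vector idx n \<pi> = d) \<longrightarrow> (\<exists>\<gamma>. G = \<gamma> *\<^sub>R ?F))"
  proof -
    have iff: "?F \<bullet> char_vector idx n \<pi> = real (card S) \<longleftrightarrow> tight K \<pi>"
      if "K_partition n K \<pi>" for \<pi>
      using two_partition_valid(2)[OF idx that] by (simp only: lhs)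
    have 1: "(\<forall>x\<in>?A. ?F \<bullet> x = real (card S) \<longrightarrow> Q x)
        \<longleftrightarrow> (\<forall>\<pi>. tight K \<pi> \<longrightarrow> Q (char_vector idx n \<pi>))" for Q
      using iff by (auto simp: tight_def)
    have 2: "(\<exists>x\<in>?A. ?F \<bullet> x = real (card S)) \<longleftrightarrow> (\<exists>\<pi>. tight K \<pi>)"
      using 1[of "\<lambda>_. False"] by blast
    show ?thesis by (simp only: 1 2)
  qed
  also have "(\<forall>G d. (\<forall>\<pi>. tight K \<pi> \<longrightarrow> G \<bullet> char_vector idx n \<pi> = d) \<longrightarrow> (\<exists>\<gamma>. G = \<gamma> *\<^sub>R ?F))
    \<longleftrightarrow> (\<forall>g d. (\<forall>\<pi>. tight K \<pi> \<longrightarrow> ?vec g \<bullet> char_vector idx n \<pi> = d) \<longrightarrow> (\<exists>\<gamma>. ?vec g = \<gamma> *\<^sub>R ?F))"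
  proof -
    have "(\<forall>G. Q G) \<longleftrightarrow> (\<forall>g. Q (?vec g))" for Q :: "real ^ 'c \<Rightarrow> bool"
      using surj by metis
    then show ?thesis .
  qed
  also have "\<dots> \<longleftrightarrow> (\<forall>g d. (\<forall>\<pi>. tight K \<pi> \<longrightarrow> (\<Sum>C\<in>\<pi>. cluster_weight g C) = d)
        \<longrightarrow> (\<exists>\<gamma>. \<forall>y\<in>coords n. g y = \<gamma> * two_partition_coeff S T y))"
  proof -
    have "(\<forall>\<pi>. tight K \<pi> \<longrightarrow> ?vec g \<bullet> char_vector idx n \<pi> = d)
        \<longleftrightarrow> (\<forall>\<pi>. tight K \<pi> \<longrightarrow> (\<Sum>C\<in>\<pi>. cluster_weight g C) = d)" for g d
      using inner_chi_char_vector[OF idx] by (metis tight_def)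
    then show ?thesis by (simp only: multiple_iff)
  qed
  finally show ?thesis .
qed

end

subsection \<open>Exchanging atoms between clusters\<close>

lemma ex_fresh:
  assumes "finite F" "card F < card A"
  shows "\<exists>x\<in>A. x \<notin> F"
  using assms card_mono by (metis not_less subsetI)

lemma card_singleton_Diff: "u \<notin> S \<Longrightarrow> card ({u} - S) = 1"
  by (simp add: insert_Diff_if)

text \<open>The quadratic edge part has third difference 0. As \<open>C\<close> has the largest
  minimum, adding it to \<open>A\<close>, \<open>B\<close> or \<open>A \<union> B\<close> does not
  change their minimum, so all representative terms cancel except that of \<open>C\<close>
  alone.\<close>

lemma cluster_weight_third_difference:
  fixes g :: "coord \<Rightarrow> real"
  defines "h \<equiv> cluster_weight g"
  assumes fin: "finite A" "finite B" "finite C"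
    and ne: "A \<noteq> {}" "B \<noteq> {}" "C \<noteq> {}"
    and disj: "A \<inter> B = {}" "A \<inter> C = {}" "B \<inter> C = {}"
    and Min: "Min A < Min C" "Min B < Min C"
  shows "h (A \<union> B \<union> C) - h (A \<union> B) - h (A \<union> C) - h (B \<union> C) + h A + h B + h C
    = (if 4 \<le> Min C then g (Rep (Min C)) else 0)"
proof -
  define e where "e i j = (if i = j then 0 else g (Edge {i, j}))" for i j
  define r where "r i = (if 4 \<le> i then g (Rep i) else 0)" for i
  define Q where "Q X Y = (\<Sum>i\<in>X. \<Sum>j\<in>Y. e i j)" for X Y
  have h: "h X = Q X X / 2 + r (Min X)" for X
    by (simp add: h_def cluster_weight_def Q_def e_def r_def)
  have Q1: "Q (X \<union> Y) Z = Q X Z + Q Y Z" and Q2: "Q Z (X \<union> Y) = Q Z X + Q Z Y"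
    if "finite X" "finite Y" "X \<inter> Y = {}" for X Y Z
    using that by (simp_all add: Q_def sum.union_disjoint sum.distrib)
  have ABC: "(A \<union> B) \<inter> C = {}" using disj by blast
  have Mins: "Min (A \<union> C) = Min A" "Min (B \<union> C) = Min B" "Min (A \<union> B \<union> C) = Min (A \<union> B)"
    "Min (A \<union> B) = Min A \<or> Min (A \<union> B) = Min B"
    using fin ne Min by (auto simp: Min_Un min_def simp del: Min_le_iff Min_less_iff)
  have Qs: "Q (A \<union> B \<union> C) (A \<union> B \<union> C) + Q A A + Q B B + Q C C
      = Q (A \<union> B) (A \<union> B) + Q (A \<union> C) (A \<union> C) + Q (B \<union> C) (B \<union> C)"
    using fin disj ABC by (simp add: Q1 Q2)
  have "h (A \<union> B \<union> C) - h (A \<union> B) - h (A \<union> C) - h (B \<union> C) + h A + h B + h C = r (Min C)"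
    unfolding h Mins using Qs by (simp add: field_simps)
  then show ?thesis by (simp only: r_def)
qed

context vertex_pair
begin

lemma excess_Un: "A \<inter> B = {} \<Longrightarrow> excess S T (A \<union> B) = excess S T A + excess S T B"
  using finite_ST
  by (simp add: excess_def Int_Un_distrib card_Un_disjoint Int_assoc Int_left_commute
      disjoint_iff)

lemma card_Diff_Un:
  "finite A \<Longrightarrow> finite B \<Longrightarrow> A \<inter> B = {} \<Longrightarrow> card (A \<union> B - S) = card (A - S) + card (B - S)"
  by (subst card_Un_disjoint[symmetric]) (auto simp: Un_Diff)

text \<open>Induction on \<open>k\<close>: split off a balanced cluster with exactly one vertex
  outside \<open>S\<close>, so that \<open>card (W - S)\<close> drops in step with \<open>k\<close>.
  While the excess is positive, a single vertex of \<open>T\<close> is removed, lowering the excess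
  too; at excess 0, a vertex outside \<open>S \<union> T\<close> or a pair \<open>{s, t}\<close>
  leaves it at 0.\<close>

lemma balanced_partition_exists:
  assumes "1 \<le> k" "finite W" "0 \<le> excess S T W" "excess S T W \<le> int k" "k \<le> card (W - S)"
  shows "\<exists>\<rho>. partition_on W \<rho> \<and> card \<rho> = k \<and> (\<forall>C\<in>\<rho>. balanced C)"
  using assms
proof (induction k arbitrary: W rule: nat_induct_at_least)
  case base
  then have "W \<noteq> {}" by auto
  moreover have "balanced W" using base by auto
  ultimately show ?case
    by (intro exI[of _ "{W}"]) (simp add: partition_on_space)
next
  case (Suc k)
  have "\<exists>C\<subseteq>W. C \<noteq> {} \<and> card (C - S) = 1 \<and> balanced C \<and>
      0 \<le> excess S T W - excess S T C \<and> excess S T W - excess S T C \<le> int k"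
  proof (cases "excess S T W > 0")
    case True
    then have "card (T \<inter> W) > 0" by (simp add: excess_def)
    then obtain t where t: "t \<in> T" "t \<in> W" by (metis Int_iff card_gt_0_iff ex_in_conv)
    then have "t \<notin> S" using disj by blast
    then have "S \<inter> {t} = {}" "T \<inter> {t} = {t}" "{t} - S = {t}" using t by auto
    then have "excess S T {t} = 1" "card ({t} - S) = 1" by (simp_all add: excess_def)
    then show ?thesis using t True Suc.prems by (intro exI[of _ "{t}"]) auto
  next
    case False
    then have zero: "excess S T W = 0" using Suc.prems by simp
    show ?thesis
    proof (cases "W \<subseteq> S \<union> T")
      case False
      then obtain u where u: "u \<in> W" "u \<notin> S" "u \<notin> T" by blast
      then have "excess S T {u} = 0" "card ({u} - S) = 1"
        by (simp_all add: excess_def card_singleton_Diff)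
      then show ?thesis using u zero by (intro exI[of _ "{u}"]) auto
    next
      case True
      then have "W - S = T \<inter> W" using disj by blast
      then have "0 < card (T \<inter> W)" using Suc.prems Suc.hyps by simp
      moreover have "card (S \<inter> W) = card (T \<inter> W)" using zero by (simp add: excess_def)
      ultimately obtain s t where st: "s \<in> S" "s \<in> W" "t \<in> T" "t \<in> W"
        by (metis Int_iff card_gt_0_iff ex_in_conv)
      then have st': "s \<notin> T" "t \<notin> S" using disj by blast+
      then have "S \<inter> {s, t} = {s}" "T \<inter> {s, t} = {t}" "{s, t} - S = {t}" using st by auto
      then have "excess S T {s, t} = 0" "card ({s, t} - S) = 1" by (simp_all add: excess_def)
      then show ?thesis using st zero by (intro exI[of _ "{s, t}"]) auto
    qed
  qed
  then obtain C where C: "C \<subseteq> W" "C \<noteq> {}" "card (C - S) = 1" "balanced C"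
      "0 \<le> excess S T W - excess S T C" "excess S T W - excess S T C \<le> int k" by blast
  have W: "W = C \<union> (W - C)" using C by blast
  have "excess S T W = excess S T C + excess S T (W - C)"
    by (subst W, rule excess_Un) blast
  moreover have "card (W - S) = card (C - S) + card (W - C - S)"
    by (subst W, rule card_Diff_Un) (use \<open>finite W\<close> C(1) finite_subset in auto)
  ultimately have "\<exists>\<rho>. partition_on (W - C) \<rho> \<and> card \<rho> = k \<and> (\<forall>C\<in>\<rho>. balanced C)"
    using C Suc.prems by (intro Suc.IH) auto
  then obtain \<rho> where \<rho>: "partition_on (W - C) \<rho>" "card \<rho> = k" "\<forall>C\<in>\<rho>. balanced C" by blast
  have U: "\<Union>\<rho> = W - C" using \<rho>(1) by (simp add: partition_on_def)
  then have "finite \<rho>" using \<open>finite W\<close> by (metis finite_Diff finite_UnionD)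
  moreover have "C \<notin> \<rho>" using U C(2) by blast
  moreover have "partition_on W (insert C \<rho>)"
    using \<rho>(1) C U by (subst partition_on_insert) (auto simp: disjnt_def)
  ultimately show ?case using \<rho> C by (intro exI[of _ "insert C \<rho>"]) simp
qed

text \<open>These and the top atoms have exactly one vertex outside \<open>S\<close>, so
  \<open>card (X - S)\<close> counts the atoms in a disjoint union \<open>X\<close> of
  atoms.\<close>

definition zero_atom :: "nat set \<Rightarrow> bool" where
  "zero_atom A \<longleftrightarrow> (\<exists>u\<in>{1..n} - (S \<union> T). A = {u}) \<or> (\<exists>s\<in>S. \<exists>t\<in>T. A = {s, t})"

definition top_atom :: "nat set \<Rightarrow> bool" where
  "top_atom A \<longleftrightarrow> (\<exists>t\<in>T. A = {t})"

lemma zero_atomI: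
  "u \<in> {1..n} \<Longrightarrow> u \<notin> S \<Longrightarrow> u \<notin> T \<Longrightarrow> zero_atom {u}"
  "s \<in> S \<Longrightarrow> t \<in> T \<Longrightarrow> zero_atom {s, t}"
  by (auto simp: zero_atom_def)

lemma top_atomI: "t \<in> T \<Longrightarrow> top_atom {t}"
  by (auto simp: top_atom_def)

lemma zero_atomD:
  assumes "zero_atom A"
  shows "A \<subseteq> {1..n}" "A \<noteq> {}" "finite A" "excess S T A = 0" "card (A - S) = 1"
proof -
  from assms consider u where "u \<in> {1..n}" "u \<notin> S" "u \<notin> T" "A = {u}"
    | s t where "s \<in> S" "t \<in> T" "A = {s, t}" unfolding zero_atom_def by blast
  then have "A \<subseteq> {1..n} \<and> A \<noteq> {} \<and> finite A \<and> excess S T A = 0 \<and> card (A - S) = 1"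
  proof cases
    case 2
    then have "s \<notin> T" "t \<notin> S" using disj by blast+
    then have "S \<inter> A = {s}" "T \<inter> A = {t}" "A - S = {t}" using 2 by auto
    then show ?thesis using 2 S T by (auto simp: excess_def)
  qed (auto simp: excess_def card_singleton_Diff)
  then show "A \<subseteq> {1..n}" "A \<noteq> {}" "finite A" "excess S T A = 0" "card (A - S) = 1" by auto
qed

lemma top_atomD:
  assumes "top_atom A"
  shows "A \<subseteq> {1..n}" "A \<noteq> {}" "finite A" "excess S T A = 1" "card (A - S) = 1"
proof -
  obtain t where t: "t \<in> T" "A = {t}" using assms by (auto simp: top_atom_def)
  then have "t \<notin> S" using disj by blast
  then show "A \<subseteq> {1..n}" "A \<noteq> {}" "finite A" "excess S T A = 1" "card (A - S) = 1"
    using t T by (auto simp: excess_def card_singleton_Diff[unfolded One_nat_def])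
qed

end

section \<open>Additivity of the cluster weight, forced by an equation on tight partitions\<close>

locale tight_equation = vertex_pair +
  fixes K :: nat and g :: "coord \<Rightarrow> real" and d :: real
  assumes K: "3 \<le> K"
    and S_less: "card S < card T" and T_less: "card T < card S + K"
    and n_ge: "card S + K + 2 \<le> n"
    and tight_eq: "\<And>\<pi>. tight K \<pi> \<Longrightarrow> (\<Sum>C\<in>\<pi>. cluster_weight g C) = d"
begin

abbreviation h :: "nat set \<Rightarrow> real" where "h \<equiv> cluster_weight g"

abbreviation defect :: "nat set \<Rightarrow> nat set \<Rightarrow> real" where
  "defect A B \<equiv> h (A \<union> B) - h A - h B"

text \<open>Two tight partitions that differ only in these two clusters satisfy the same equation.
  The point is that the two clusters can be completed by \<open>K - 2\<close> further balanced
  ones.\<close>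

lemma exchange:
  assumes ne: "X \<noteq> {}" "Y \<noteq> {}" "X' \<noteq> {}" "Y' \<noteq> {}"
    and V: "X \<union> Y \<subseteq> {1..n}" and disjoint: "X \<inter> Y = {}" "X' \<inter> Y' = {}"
    and same: "X' \<union> Y' = X \<union> Y"
    and bal: "balanced X" "balanced Y" "balanced X'" "balanced Y'"
    and excess: "excess S T (X \<union> Y) = 1" and small: "card (X \<union> Y - S) \<le> 4"
  shows "h X + h Y = h X' + h Y'"
proof -
  let ?W = "{1..n} - (X \<union> Y)"
  have "{1..n} = (X \<union> Y) \<union> ?W" using V by blast
  then have "excess S T {1..n} = excess S T (X \<union> Y) + excess S T ?W"
    and "card ({1..n} - S) = card (X \<union> Y - S) + card (?W - S)"
    using excess_Un[of "X \<union> Y" ?W] card_Diff_Un[of "X \<union> Y" ?W] finite_subset[OF V] by auto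
  moreover have "excess S T {1..n} = int (card T) - int (card S)"
    using S T by (simp add: excess_def Int_absorb2)
  moreover have "card ({1..n} - S) = n - card S"
    using S finite_ST by (simp add: card_Diff_subset)
  \<comment> \<open>The rest has excess \<open>card T - card S - 1\<close>, between 0 and
    \<open>K - 2\<close> by condition (i), and by condition (ii) at least
    \<open>n - card S - 4 \<ge> K - 2\<close> vertices outside \<open>S\<close>. This is the origin
    of the bound 4 in \<open>small\<close>.\<close>
  ultimately have "\<exists>\<rho>. partition_on ?W \<rho> \<and> card \<rho> = K - 2 \<and> (\<forall>C\<in>\<rho>. balanced C)"
    using excess small K S_less T_less n_ge by (intro balanced_partition_exists) auto
  then obtain \<rho> where \<rho>: "partition_on ?W \<rho>" "card \<rho> = K - 2" "\<forall>C\<in>\<rho>. balanced C" by blast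
  have U: "\<Union>\<rho> = ?W" using \<rho>(1) by (simp add: partition_on_def)
  then have fin: "finite \<rho>" by (metis finite_Diff finite_UnionD finite_atLeastAtMost)
  have "h P + h Q + (\<Sum>C\<in>\<rho>. h C) = d"
    if "P \<noteq> {}" "Q \<noteq> {}" "P \<inter> Q = {}" "P \<union> Q = X \<union> Y" "balanced P" "balanced Q" for P Q
  proof -
    have notin: "P \<notin> \<rho>" "Q \<notin> \<rho>" "P \<noteq> Q" using U that(1-4) by blast+
    have "{1..n} - P - Q = ?W" using that(4) by blast
    then have "partition_on ({1..n} - P) (insert Q \<rho>)"
      using \<rho>(1) that(2,3,4) U V by (subst partition_on_insert) (auto simp: disjnt_iff)
    then have "partition_on {1..n} (insert P (insert Q \<rho>))"
      using that(1,3,4) U V by (subst partition_on_insert) (auto simp: disjnt_iff)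
    moreover have "card (insert P (insert Q \<rho>)) = K"
      using notin fin \<rho>(2) K by simp
    ultimately have "tight K (insert P (insert Q \<rho>))"
      using \<rho>(3) that by (simp add: tight_def K_partition_def)
    from tight_eq[OF this] show ?thesis using notin fin by simp
  qed
  from this[of X Y] this[of X' Y'] show ?thesis using assms by simp
qed

lemma atoms_exchange:
  assumes "X \<noteq> {}" "Y \<noteq> {}" "X' \<noteq> {}" "Y' \<noteq> {}" "X \<union> Y \<subseteq> {1..n}" "X \<inter> Y = {}" "X' \<inter> Y' = {}"
    and "X' \<union> Y' = X \<union> Y" and "balanced X" "balanced X'" "excess S T X + excess S T Y = 1"
    and "card (X - S) + card (Y - S) \<le> 4"
  shows "h X + h Y = h X' + h Y'"
proof -
  have "excess S T X' + excess S T Y' = 1"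
    using assms excess_Un by metis
  moreover have "finite X" "finite Y" using assms(5) finite_subset by auto
  ultimately show ?thesis
    using assms excess_Un[of X Y] card_Diff_Un[of X Y] by (intro exchange) auto
qed

text \<open>The three groupings of the atoms into two clusters, \<open>A \<union> B | C\<close>,
  \<open>A \<union> C | B\<close> and \<open>A | B \<union> C\<close>, all have the same total
  weight by \<open>atoms_exchange\<close>.\<close>

lemma defect_top_zero:
  assumes "top_atom A" "zero_atom B" "zero_atom C" "A \<inter> B = {}" "A \<inter> C = {}" "B \<inter> C = {}"
  shows "defect A B = defect A C" "defect A B = defect B C"
proof -
  note D = top_atomD[OF assms(1)] zero_atomD[OF assms(2)] zero_atomD[OF assms(3)]
  have ex: "excess S T (A \<union> B) = 1" "excess S T (A \<union> C) = 1"
    using assms(4-6) D by (simp_all add: excess_Un)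
  have card: "card (A \<union> B - S) = 2"
    using assms(4-6) D by (simp add: card_Diff_Un)
  have "h (A \<union> B) + h C = h (A \<union> C) + h B"
    by (rule atoms_exchange) (use assms(4-6) D ex card in auto)
  moreover have "h (A \<union> B) + h C = h A + h (B \<union> C)"
    by (rule atoms_exchange) (use assms(4-6) D ex card in auto)
  ultimately show "defect A B = defect A C" "defect A B = defect B C" by linarith+
qed

text \<open>Four atoms are regrouped into two clusters, which uses up the bound 4 of
  \<open>exchange\<close>. This expresses the weight of three atoms through unions of two.\<close>

lemma weight_quadruple:
  assumes "top_atom A" "zero_atom B" "zero_atom C" "zero_atom D"
    and disjoint: "A \<inter> B = {}" "A \<inter> C = {}" "B \<inter> C = {}" "A \<inter> D = {}" "B \<inter> D = {}" "C \<inter> D = {}"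
  shows "h (A \<union> B \<union> C) + h D = h (A \<union> B) + h (C \<union> D)"
    and "h A + h (B \<union> C \<union> D) = h (A \<union> B) + h (C \<union> D)"
proof -
  note D = top_atomD[OF assms(1)] zero_atomD[OF assms(2)] zero_atomD[OF assms(3)]
    zero_atomD[OF assms(4)]
  have dis: "(A \<union> B) \<inter> C = {}" "(B \<union> C) \<inter> D = {}" using disjoint by auto
  have ex: "excess S T (A \<union> B) = 1" "excess S T (A \<union> B \<union> C) = 1"
      "excess S T (B \<union> C \<union> D) = 0"
    using disjoint D dis by (simp_all add: excess_Un)
  have card: "card (A \<union> B \<union> C - S) = 3" "card (B \<union> C \<union> D - S) = 3"
    using disjoint D dis by (simp_all add: card_Diff_Un)
  show "h (A \<union> B \<union> C) + h D = h (A \<union> B) + h (C \<union> D)"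
    by (rule atoms_exchange) (use disjoint D ex card in auto)
  show "h A + h (B \<union> C \<union> D) = h (A \<union> B) + h (C \<union> D)"
    by (rule atoms_exchange) (use disjoint D ex card in auto)
qed

text \<open>Both sides come from splitting \<open>{s, t, t'}\<close>, a set of excess 1, into two
  balanced clusters.\<close>

lemma weight_swap:
  assumes "s \<in> S" "t \<in> T" "t' \<in> T" "t \<noteq> t'"
  shows "h {t} + h {s, t'} = h {t'} + h {s, t}"
proof (rule exchange)
  have st: "s \<noteq> t" "s \<noteq> t'" using assms disj by blast+
  note a = zero_atomD[OF zero_atomI(2)] top_atomD[OF top_atomI]
  have dis: "{t} \<inter> {s, t'} = {}" "{t'} \<inter> {s, t} = {}" using st assms by auto
  then show "{t} \<inter> {s, t'} = {}" "{t'} \<inter> {s, t} = {}" by auto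
  show "balanced {t}" "balanced {s, t'}" "balanced {t'}" "balanced {s, t}"
    using assms by (simp_all add: a)
  show "excess S T ({t} \<union> {s, t'}) = 1"
    unfolding excess_Un[OF dis(1)] using assms by (simp add: a)
  show "card ({t} \<union> {s, t'} - S) \<le> 4"
    by (subst card_Diff_Un[OF _ _ dis(1)]) (use assms in \<open>simp_all add: a\<close>)
  show "{t} \<union> {s, t'} \<subseteq> {1..n}" using assms S T by auto
qed auto

lemma defect_swap:
  assumes "s \<in> S" "t \<in> T" "t' \<in> T" "t \<noteq> t'"
  shows "defect {t} {s, t'} = defect {t'} {s, t}"
proof -
  have "{t} \<union> {s, t'} = {t'} \<union> {s, t}" by auto
  then show ?thesis using weight_swap[OF assms] by simp
qed

lemma card_V: "card ({1..n} - (S \<union> T)) + card S + card T = n"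
proof -
  have "card (S \<union> T) = card S + card T" using finite_ST disj by (simp add: card_Un_disjoint)
  moreover have "card ({1..n} - (S \<union> T)) = n - card (S \<union> T)"
    using S T finite_ST by (simp add: card_Diff_subset)
  moreover have "card (S \<union> T) \<le> n" using card_mono[of "{1..n}" "S \<union> T"] S T by simp
  ultimately show ?thesis by simp
qed

text \<open>A vertex \<open>u0\<close> outside \<open>S \<union> T\<close> gives a reference atom
  \<open>{u0}\<close>: \<open>defect_top_zero\<close> replaces any zero atom by it, and
  \<open>defect_swap\<close> changes the top vertex. Without such a vertex only pairs
  \<open>{s, t}\<close> are zero atoms, and the constant is carried along by swapping the top vertex
  with the partner and by changing pairs.\<close>

lemma defect_const:
  obtains q where "\<And>t A. t \<in> T \<Longrightarrow> zero_atom A \<Longrightarrow> t \<notin> A \<Longrightarrow> defect {t} A = q"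
proof (cases "{1..n} - (S \<union> T) = {}")
  case False
  then obtain u0 where u0: "u0 \<in> {1..n}" "u0 \<notin> S" "u0 \<notin> T" by blast
  obtain s0 where s0: "s0 \<in> S" using S by blast
  obtain t0 where t0: "t0 \<in> T" using T by blast
  have other: "\<exists>t'\<in>T. t' \<noteq> t" for t
    using ex_fresh[of "{t}" T] S_less card_S_pos by auto
  have a: "defect {t} {u} = defect {t} {s, t'}"
    if "t \<in> T" "u \<in> {1..n}" "u \<notin> S" "u \<notin> T" "s \<in> S" "t' \<in> T" "t \<noteq> t'" for t u s t'
  proof (rule defect_top_zero(1))
    show "top_atom {t}" "zero_atom {u}" "zero_atom {s, t'}"
      using that by (simp_all add: top_atomI zero_atomI)
    show "{t} \<inter> {u} = {}" "{t} \<inter> {s, t'} = {}" "{u} \<inter> {s, t'} = {}"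
      using that S_neq_T by auto
  qed
  \<comment> \<open>A detour through pairs: \<open>{u0}\<close> is replaced by
    \<open>{s0, t'}\<close>, then \<open>t\<close> and \<open>t'\<close> are swapped, and
    \<open>{s0, t}\<close> is replaced by \<open>{u0}\<close>.\<close>
  have b: "defect {t} {u0} = defect {t'} {u0}" if t: "t \<in> T" "t' \<in> T" for t t'
  proof (cases "t = t'")
    case False
    then show ?thesis
      using a[of t u0 s0 t'] a[of t' u0 s0 t] defect_swap[of s0 t t'] t u0 s0 by simp
  qed simp
  show ?thesis
  proof (rule that)
    fix t A assume t: "t \<in> T" and A: "zero_atom A" "t \<notin> A"
    have "defect {t} A = defect {t} {u0}"
      using A(1)[unfolded zero_atom_def]
    proof (elim disjE bexE)
      fix u assume u: "u \<in> {1..n} - (S \<union> T)" "A = {u}"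
      obtain t' where "t' \<in> T" "t' \<noteq> t" using other by blast
      then show ?thesis using a[of t u s0 t'] a[of t u0 s0 t'] t u u0 s0 by simp
    next
      fix s t' assume "s \<in> S" "t' \<in> T" "A = {s, t'}"
      then show ?thesis using a[of t u0 s t'] t u0 A(2) by simp
    qed
    then show "defect {t} A = defect {t0} {u0}" using b[OF t t0] by simp
  qed
next
  case True
  then have "card S + card T = n" using card_V by (simp only: card.empty)
  \<comment> \<open>Here \<open>card T = n - card S \<ge> K + 2\<close>, and then
    \<open>card S > card T - K \<ge> 2\<close>; this leaves room for the detours below.\<close>
  then have cards: "2 \<le> card S" "3 \<le> card T" using n_ge S_less T_less K by auto
  define f where "f s t t' = defect {t} {s, t'}" for s t t'
  have swap: "f s t t' = f s t' t" if "s \<in> S" "t \<in> T" "t' \<in> T" "t \<noteq> t'" for s t t'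
    unfolding f_def by (rule defect_swap) (use that in auto)
  have change: "f s t t' = f s' t t''"
    if "s \<in> S" "s' \<in> S" "s \<noteq> s'" "t \<in> T" "t' \<in> T" "t'' \<in> T" "t \<noteq> t'" "t \<noteq> t''" "t' \<noteq> t''"
    for s s' t t' t''
    unfolding f_def
  proof (rule defect_top_zero(1))
    show "top_atom {t}" "zero_atom {s, t'}" "zero_atom {s', t''}"
      using that by (simp_all add: top_atomI zero_atomI)
    show "{t} \<inter> {s, t'} = {}" "{t} \<inter> {s', t''} = {}" "{s, t'} \<inter> {s', t''} = {}"
      using that S_neq_T by auto
  qed
  \<comment> \<open>The top vertex changes while the partner \<open>t'\<close> stays: pass to
    another \<open>s'\<close> with partner \<open>t''\<close>, swap \<open>t''\<close> with the top
    vertex \<open>t\<close>, and return to \<open>s\<close> with partner \<open>t'\<close>.\<close>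
  have first: "f s t t' = f s t'' t'"
    if "s \<in> S" "t \<in> T" "t' \<in> T" "t'' \<in> T" "t \<noteq> t'" "t \<noteq> t''" "t' \<noteq> t''" for s t t' t''
  proof -
    obtain s' where s': "s' \<in> S" "s' \<noteq> s" using ex_fresh[of "{s}" S] cards by auto
    have "f s t t' = f s' t t''" using that s' by (intro change) auto
    also have "\<dots> = f s' t'' t" using that s' by (intro swap) auto
    also have "\<dots> = f s t'' t'" using that s' by (intro change) auto
    finally show ?thesis .
  qed
  \<comment> \<open>Replacing the first entry and swapping the two entries connect all ordered pairs
    of distinct vertices of \<open>T\<close>.\<close>
  have all: "f s a b = f s c e"
    if "s \<in> S" "a \<in> T" "b \<in> T" "c \<in> T" "e \<in> T" "a \<noteq> b" "c \<noteq> e" for s a b c e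
  proof -
    have first': "f s t t' = f s t'' t'"
      if "t \<in> T" "t' \<in> T" "t'' \<in> T" "t \<noteq> t'" "t' \<noteq> t''" for t t' t''
      using first[of s t t' t''] that \<open>s \<in> S\<close> by (cases "t = t''") auto
    show ?thesis
    proof (cases "c = b")
      case True
      have "f s a b = f s e b" using that True by (intro first') auto
      also have "\<dots> = f s b e" using that True by (intro swap) auto
      finally show ?thesis using True by simp
    next
      case False
      have "f s a b = f s c b" using that False by (intro first') auto
      also have "\<dots> = f s b c" using that False by (intro swap) auto
      also have "\<dots> = f s e c" using that False by (intro first') auto
      also have "\<dots> = f s c e" using that False by (intro swap) auto
      finally show ?thesis .
    qed
  qed
  obtain s0 where s0: "s0 \<in> S" using S by blast
  obtain t0 where t0: "t0 \<in> T" using T by blast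
  obtain t1 where t1: "t1 \<in> T" "t1 \<noteq> t0" using ex_fresh[of "{t0}" T] cards by auto
  obtain t2 where t2: "t2 \<in> T" "t2 \<notin> {t0, t1}" using ex_fresh[of "{t0, t1}" T] cards t1 by auto
  have f_eq: "f s t t' = f s0 t0 t1" if st: "s \<in> S" "t \<in> T" "t' \<in> T" "t \<noteq> t'" for s t t'
  proof (cases "s = s0")
    case True
    then show ?thesis using all[of s t t' t0 t1] st t0 t1 by simp
  next
    case False
    \<comment> \<open>Changing \<open>s\<close> by \<open>change\<close> requires a new partner as
      well, hence the third vertex \<open>t2\<close>.\<close>
    then have "f s t0 t2 = f s0 t0 t1" using st s0 t0 t1 t2 by (intro change) auto
    then show ?thesis using all[of s t t' t0 t2] st t0 t2 by simp
  qed
  show ?thesis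
  proof (rule that)
    fix t A assume t: "t \<in> T" and A: "zero_atom A" "t \<notin> A"
    then obtain s t' where "s \<in> S" "t' \<in> T" "A = {s, t'}"
      using True unfolding zero_atom_def by blast
    then show "defect {t} A = f s0 t0 t1" using f_eq[of s t t'] t A(2) by (simp add: f_def)
  qed
qed

text \<open>Additivity of \<open>h\<close> up to the constant \<open>q\<close>. At most one of the
  atoms is a top atom, as the union has to be balanced.\<close>

definition common_defect :: "real \<Rightarrow> bool" where
  "common_defect q \<longleftrightarrow> (\<forall>A B. (zero_atom A \<or> top_atom A) \<and> zero_atom B \<and> A \<inter> B = {} \<longrightarrow> defect A B = q)"

lemma ex_top_outside:
  assumes "excess S T X = 0"
  obtains t where "t \<in> T" "t \<notin> X"
proof -
  have "card (T \<inter> X) = card (S \<inter> X)" using assms by (simp add: excess_def)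
  also have "\<dots> \<le> card S" using finite_ST by (simp add: card_mono)
  finally have "card (T \<inter> X) < card T" using S_less by simp
  then show ?thesis using ex_fresh[of "T \<inter> X" T] finite_ST that by auto
qed

text \<open>If some \<open>s\<close> lies outside \<open>X\<close>, so does a partner in
  \<open>T\<close>, since \<open>X\<close> has exactly one more vertex of \<open>T\<close> than of
  \<open>S\<close>. If \<open>S \<subseteq> X\<close>, counting yields a vertex outside
  \<open>S \<union> T\<close>.\<close>

lemma ex_zero_outside:
  assumes X: "X \<subseteq> {1..n}" "excess S T X = 1" "card (X - S) \<le> 3"
  obtains A where "zero_atom A" "A \<inter> X = {}"
proof (cases "S \<subseteq> X")
  case False
  then obtain s where s: "s \<in> S" "s \<notin> X" by blast
  then have "card (S \<inter> X) < card S" using finite_ST by (intro psubset_card_mono) auto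
  then have "card (T \<inter> X) < card T" using X S_less by (simp add: excess_def)
  then obtain t where "t \<in> T" "t \<notin> X" using ex_fresh[of "T \<inter> X" T] finite_ST by auto
  then show ?thesis using s by (intro that[of "{s, t}"] zero_atomI) auto
next
  case True
  have "\<not> {1..n} - (S \<union> T) \<subseteq> X"
  proof
    \<comment> \<open>\<open>X - S\<close> would contain all \<open>n - card S - card T\<close>
      vertices outside \<open>S \<union> T\<close> and \<open>card S + 1\<close> vertices of
      \<open>T\<close>. By (i) and (ii) these are at least
      \<open>K + 3 - (card T - card S) \<ge> 4\<close>, too many.\<close>
    assume U: "{1..n} - (S \<union> T) \<subseteq> X"
    have "card (T \<inter> X) = card S + 1"
      using X(2) True by (simp add: excess_def Int_absorb2)
    moreover have "({1..n} - (S \<union> T)) \<union> (T \<inter> X) \<subseteq> X - S" using U disj by blast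
    then have "card (({1..n} - (S \<union> T)) \<union> (T \<inter> X)) \<le> card (X - S)"
      using X(1) finite_subset by (intro card_mono) auto
    moreover have "card (({1..n} - (S \<union> T)) \<union> (T \<inter> X))
        = card ({1..n} - (S \<union> T)) + card (T \<inter> X)"
      using finite_ST by (intro card_Un_disjoint) auto
    ultimately show False using X(3) card_V n_ge S_less T_less K by linarith
  qed
  then obtain u where "u \<in> {1..n}" "u \<notin> S" "u \<notin> T" "u \<notin> X" by blast
  then show ?thesis by (intro that[of "{u}"] zero_atomI) auto
qed

text \<open>\<open>defect_const\<close> covers a top atom with a zero atom. For two zero atoms, a
  vertex of \<open>T\<close> outside both gives a third atom, and \<open>defect_top_zero\<close>
  transfers the constant.\<close>

lemma ex_common_defect: "\<exists>q. common_defect q"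
proof -
  obtain q where q: "\<And>t A. t \<in> T \<Longrightarrow> zero_atom A \<Longrightarrow> t \<notin> A \<Longrightarrow> defect {t} A = q"
    using defect_const by blast
  then have top: "defect A B = q" if "top_atom A" "zero_atom B" "A \<inter> B = {}" for A B
  proof -
    obtain t where "t \<in> T" "A = {t}" using \<open>top_atom A\<close> unfolding top_atom_def by blast
    then show ?thesis using q[of t B] that(2,3) by simp
  qed
  have zero: "defect A B = q" if AB: "zero_atom A" "zero_atom B" "A \<inter> B = {}" for A B
  proof -
    have "excess S T (A \<union> B) = 0" using AB zero_atomD(4) by (simp add: excess_Un)
    then obtain t where t: "t \<in> T" "t \<notin> A \<union> B" by (rule ex_top_outside)
    then have "defect {t} A = defect A B"
      using AB top_atomI[OF t(1)] by (intro defect_top_zero(2)) simp_all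
    moreover have "defect {t} A = q" using q[OF t(1) AB(1)] t(2) by simp
    ultimately show ?thesis by simp
  qed
  have "common_defect q"
    unfolding common_defect_def using top zero by metis
  then show ?thesis ..
qed

abbreviation third_difference :: "nat set \<Rightarrow> nat set \<Rightarrow> nat set \<Rightarrow> real" where
  "third_difference A B C \<equiv>
     h (A \<union> B \<union> C) - h (A \<union> B) - h (A \<union> C) - h (B \<union> C) + h A + h B + h C"

text \<open>A fourth atom \<open>Z\<close> splits off \<open>C\<close>: comparing
  \<open>A \<union> B \<union> C | Z\<close> with \<open>A \<union> B | C \<union> Z\<close> gives
  \<open>h (A \<union> B \<union> C) = h (A \<union> B) + h C + q\<close>. The pairs
  \<open>A \<union> C\<close> and \<open>B \<union> C\<close> contribute \<open>- q\<close> each,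
  which makes \<open>- q\<close> in total.\<close>

lemma third_difference_top:
  assumes q: "common_defect q" and atoms: "top_atom A" "zero_atom B" "zero_atom C"
    and dis: "A \<inter> B = {}" "A \<inter> C = {}" "B \<inter> C = {}"
  shows "third_difference A B C = - q"
proof -
  note D = top_atomD[OF atoms(1)] zero_atomD[OF atoms(2)] zero_atomD[OF atoms(3)]
  have dis': "(A \<union> B) \<inter> C = {}" using dis by blast
  have "excess S T (A \<union> B \<union> C) = 1" "card (A \<union> B \<union> C - S) = 3"
    using dis dis' D by (simp_all add: excess_Un card_Diff_Un)
  moreover have "A \<union> B \<union> C \<subseteq> {1..n}" using D by blast
  ultimately obtain Z where Z: "zero_atom Z" "Z \<inter> (A \<union> B \<union> C) = {}"
    using ex_zero_outside[of "A \<union> B \<union> C"] by (metis order_refl)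
  then have Z': "A \<inter> Z = {}" "B \<inter> Z = {}" "C \<inter> Z = {}" by blast+
  have "h (A \<union> B \<union> C) + h Z = h (A \<union> B) + h (C \<union> Z)"
    by (rule weight_quadruple(1)) (use atoms dis Z Z' in auto)
  moreover have "defect C Z = q" "defect A C = q" "defect B C = q"
    using q atoms dis Z(1) Z' unfolding common_defect_def by blast+
  ultimately show ?thesis by linarith
qed

text \<open>Now the added atom is a vertex of \<open>T\<close>, which takes \<open>A\<close> away:
  \<open>h (A \<union> B \<union> C) = h A + h (B \<union> C) + q\<close>.\<close>

lemma third_difference_zero:
  assumes q: "common_defect q" and atoms: "zero_atom A" "zero_atom B" "zero_atom C"
    and dis: "A \<inter> B = {}" "A \<inter> C = {}" "B \<inter> C = {}"
  shows "third_difference A B C = - q"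
proof -
  note D = zero_atomD[OF atoms(1)] zero_atomD[OF atoms(2)] zero_atomD[OF atoms(3)]
  have dis': "(A \<union> B) \<inter> C = {}" using dis by blast
  have "excess S T (A \<union> B \<union> C) = 0"
    using dis dis' D by (simp add: excess_Un)
  then obtain t where t: "t \<in> T" "t \<notin> A \<union> B \<union> C" by (rule ex_top_outside)
  then have t': "top_atom {t}" "{t} \<inter> A = {}" "{t} \<inter> B = {}" "{t} \<inter> C = {}"
    by (auto intro: top_atomI)
  have "h {t} + h (A \<union> B \<union> C) = h ({t} \<union> A) + h (B \<union> C)"
    by (rule weight_quadruple(2)) (use atoms dis t' in auto)
  moreover have "defect {t} A = q" "defect A B = q" "defect A C = q"
    using q atoms dis t' unfolding common_defect_def by blast+
  ultimately show ?thesis by linarith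
qed

text \<open>By \<open>ex\<close> at most one of the atoms is a top atom, and by symmetry of the
  third difference it may be put first.\<close>

lemma third_difference_atoms:
  assumes q: "common_defect q"
    and atoms: "zero_atom A \<or> top_atom A" "zero_atom B \<or> top_atom B" "zero_atom C \<or> top_atom C"
    and dis: "A \<inter> B = {}" "A \<inter> C = {}" "B \<inter> C = {}"
    and ex: "excess S T A + excess S T B + excess S T C \<le> 1"
  shows "third_difference A B C = - q"
proof -
  consider "zero_atom A" "zero_atom B" "zero_atom C" | "top_atom A" "zero_atom B" "zero_atom C"
    | "zero_atom A" "top_atom B" "zero_atom C" | "zero_atom A" "zero_atom B" "top_atom C"
    using atoms ex zero_atomD(4) top_atomD(4) by fastforce
  then show ?thesis
  proof cases
    case 3
    have "B \<inter> A = {}" using dis by blast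
    then have "third_difference B A C = - q"
      using 3 dis q by (intro third_difference_top) auto
    then show ?thesis by (simp add: Un_commute[of B A])
  next
    case 4
    have "C \<inter> A = {}" "C \<inter> B = {}" using dis by blast+
    then have "third_difference C A B = - q"
      using 4 dis q by (intro third_difference_top) auto
    then show ?thesis by (simp add: Un_ac)
  qed (use third_difference_zero third_difference_top q dis in auto)
qed

end

section \<open>Representative and edge coefficients under all four conditions\<close>

locale facet_conditions = tight_equation +
  assumes larger: "\<And>s. s \<in> S \<Longrightarrow> \<exists>t\<in>T. s < t"
    and free: "card S = 1 \<Longrightarrow> \<exists>u\<in>{1, 2, 3}. u \<notin> S \<and> u \<notin> T"
begin

text \<open>The input of \<open>cluster_weight_third_difference\<close> for vertex \<open>i\<close>:
  when \<open>x\<close> and \<open>y\<close> are below \<open>i\<close>, they keep the minima of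
  \<open>A\<close> and \<open>B\<close> below that of \<open>C\<close>.\<close>

definition atom_triple :: "nat \<Rightarrow> nat \<Rightarrow> nat \<Rightarrow> nat set \<Rightarrow> nat set \<Rightarrow> nat set \<Rightarrow> bool" where
  "atom_triple x y i A B C \<longleftrightarrow>
     (zero_atom A \<or> top_atom A) \<and> (zero_atom B \<or> top_atom B) \<and> (zero_atom C \<or> top_atom C)
     \<and> A \<inter> B = {} \<and> A \<inter> C = {} \<and> B \<inter> C = {}
     \<and> excess S T A + excess S T B + excess S T C \<le> 1
     \<and> x \<in> A \<and> y \<in> B \<and> Min C = i"

text \<open>Only \<open>v\<close> in \<open>S\<close> needs a partner. Then \<open>F\<close> misses
  a vertex of \<open>S\<close>, so it has at most \<open>card S\<close>, hence not all, vertices of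
  \<open>T\<close>. The last conclusion keeps other vertices outside \<open>T\<close> free for later
  atoms.\<close>

lemma zero_atom_cover:
  assumes "v \<in> {1..n}" "v \<notin> T" "v \<notin> F" "excess S T F \<le> 1"
  obtains A where "zero_atom A" "v \<in> A" "A \<inter> F = {}" "A \<subseteq> insert v T"
proof (cases "v \<in> S")
  case True
  then have "card (S \<inter> F) < card S" using assms finite_ST by (intro psubset_card_mono) auto
  then have "card (T \<inter> F) < card T" using assms S_less by (simp add: excess_def)
  then obtain t where "t \<in> T" "t \<notin> F" using ex_fresh[of "T \<inter> F" T] finite_ST by auto
  then show ?thesis using assms True by (intro that[of "{v, t}"]) (auto intro: zero_atomI)
next
  case False
  then show ?thesis using assms by (intro that[of "{v}"]) (auto intro: zero_atomI)
qed

text \<open>Only one top atom may occur. For \<open>i\<close> in \<open>T\<close> it is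
  \<open>{i}\<close>, since a partner in \<open>S\<close> could be smaller than \<open>i\<close>;
  then \<open>x\<close>, and \<open>y\<close> if it is in \<open>T\<close>, get partners in
  \<open>S\<close>. Otherwise it is \<open>{x}\<close>, and only \<open>y\<close> may need a partner
  in \<open>S\<close>. The assumption \<open>free\<close> ensures two vertices in \<open>S\<close>
  where two are required.\<close>

lemma ex_atom_triple_T:
  assumes V: "x \<in> {1..n}" "y \<in> {1..n}" "i \<in> {1..n}" and less: "x < i" "y < i" "x \<noteq> y"
    and free: "card S = 1 \<Longrightarrow> i \<notin> S \<union> T \<or> y \<notin> S \<union> T"
    and x: "x \<in> T"
  shows "\<exists>A B C. atom_triple x y i A B C"
proof -
  have two: "\<exists>s\<in>S. s \<noteq> v" if "2 \<le> card S" for v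
    using ex_fresh[of "{v}" S] that by auto
  have one: "2 \<le> card S" if "card S \<noteq> 1" using that card_S_pos by linarith
  show ?thesis
  proof (cases "i \<in> T")
    case True
    obtain s where s: "s \<in> S" "s \<noteq> y"
    proof (cases "y \<in> S \<union> T")
      case True
      then show ?thesis using free one two \<open>i \<in> T\<close> that by blast
    next
      case False
      then show ?thesis using S that by blast
    qed
    have sT: "s \<notin> T" "x \<noteq> s" "i \<noteq> s" using s x True S_neq_T by blast+
    have A: "zero_atom {s, x}" using s(1) x by (rule zero_atomI)
    have C: "top_atom {i}" using True by (rule top_atomI)
    have dis: "{s, x} \<inter> {i} = {}" using sT less by auto
    obtain B where B: "zero_atom B" "y \<in> B" "B \<inter> ({s, x} \<union> {i}) = {}"
    proof (cases "y \<in> T")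
      case True
      then have "card S \<noteq> 1" using free \<open>i \<in> T\<close> by blast
      then obtain s' where s': "s' \<in> S" "s' \<noteq> s" using one two by blast
      have "s' \<noteq> x" "s' \<noteq> i" "y \<noteq> s" using s' s x True \<open>i \<in> T\<close> S_neq_T by blast+
      then show ?thesis
        using s' True less by (intro that[of "{s', y}"] zero_atomI) auto
    next
      case False
      have "excess S T ({s, x} \<union> {i}) \<le> 1"
        by (simp only: excess_Un[OF dis] zero_atomD[OF A] top_atomD[OF C])
      then show ?thesis
        using zero_atom_cover[of y "{s, x} \<union> {i}"] False V less s that by (metis UnE insertE empty_iff less_irrefl)
    qed
    have "atom_triple x y i {s, x} B {i}"
      unfolding atom_triple_def
      using A B C dis by (auto simp: zero_atomD(4) top_atomD(4))
    then show ?thesis by blast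
  next
    case False
    obtain C where C: "zero_atom C" "Min C = i" "C \<inter> {x, y} = {}" "C \<subseteq> insert i T" "i \<in> C"
    proof (cases "i \<in> S")
      case True
      \<comment> \<open>Condition (iii): a partner larger than \<open>i\<close> keeps
        \<open>i\<close> the minimum of \<open>C\<close>.\<close>
      then obtain t where t: "t \<in> T" "i < t" using larger by blast
      show ?thesis
      proof (rule that[of "{i, t}"])
        show "zero_atom {i, t}" using True t by (intro zero_atomI)
      qed (use t less in auto)
    next
      case False
      show ?thesis
      proof (rule that[of "{i}"])
        show "zero_atom {i}" using False \<open>i \<notin> T\<close> V by (intro zero_atomI)
      qed (use less in auto)
    qed
    have A: "top_atom {x}" using x by (rule top_atomI)
    have dis: "{x} \<inter> C = {}" using C by auto
    obtain B where B: "zero_atom B" "y \<in> B" "B \<inter> ({x} \<union> C) = {}"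
    proof (cases "y \<in> T")
      case True
      obtain s where s: "s \<in> S" "s \<noteq> i"
      proof (cases "i \<in> S")
        case True
        then have "card S \<noteq> 1" using free \<open>y \<in> T\<close> by blast
        then show ?thesis using one two that by blast
      next
        case False
        then show ?thesis using S that by blast
      qed
      then have "s \<notin> C" "s \<noteq> x" using C(4) x S_neq_T by blast+
      then show ?thesis
        using s True C(3) less by (intro that[of "{s, y}"] zero_atomI) auto
    next
      case False
      have "excess S T ({x} \<union> C) \<le> 1"
        by (simp only: excess_Un[OF dis] zero_atomD[OF C(1)] top_atomD[OF A])
      moreover have "y \<notin> {x} \<union> C" using C(3) less by auto
      ultimately show ?thesis
        using zero_atom_cover[of y "{x} \<union> C"] False V that by metis
    qed
    have "atom_triple x y i {x} B C"
      unfolding atom_triple_def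
      using A B C dis by (auto simp: zero_atomD(4) top_atomD(4))
    then show ?thesis by blast
  qed
qed

text \<open>\<open>A\<close> and \<open>B\<close> are interchangeable, so a member of
  \<open>T\<close> among \<open>x\<close> and \<open>y\<close> leads to
  \<open>ex_atom_triple_T\<close>. Otherwise \<open>C\<close> is built first, with a larger partner
  from condition (iii) if \<open>i\<close> is in \<open>S\<close>, and
  \<open>zero_atom_cover\<close> supplies \<open>A\<close> and \<open>B\<close>.\<close>

lemma ex_atom_triple:
  assumes V: "x \<in> {1..n}" "y \<in> {1..n}" "i \<in> {1..n}" and less: "x < i" "y < i" "x \<noteq> y"
    and free: "card S = 1 \<Longrightarrow> \<not> {x, y, i} \<subseteq> S \<union> T"
  shows "\<exists>A B C. atom_triple x y i A B C"
proof -
  consider "x \<in> T" | "y \<in> T" | "x \<notin> T" "y \<notin> T" by blast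
  then show ?thesis
  proof cases
    case 1
    then show ?thesis using assms by (intro ex_atom_triple_T) auto
  next
    case 2
    then have "\<exists>A B C. atom_triple y x i A B C" using assms by (intro ex_atom_triple_T) auto
    then obtain A B C where "atom_triple y x i A B C" by blast
    then have "atom_triple x y i B A C"
      unfolding atom_triple_def by (simp add: Int_commute add.commute)
    then show ?thesis by blast
  next
    case 3
    obtain C where C: "zero_atom C \<or> top_atom C" "Min C = i" "C \<inter> {x, y} = {}"
    proof (cases "i \<in> S")
      case True
      then obtain t where t: "t \<in> T" "i < t" using larger by blast
      show ?thesis
      proof (rule that[of "{i, t}"])
        show "zero_atom {i, t} \<or> top_atom {i, t}" using True t zero_atomI by blast
      qed (use t less in auto)
    next
      case False
      show ?thesis
      proof (rule that[of "{i}"])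
        show "zero_atom {i} \<or> top_atom {i}" using False V zero_atomI top_atomI by blast
      qed (use less in auto)
    qed
    have exC: "excess S T C \<le> 1" using C(1) zero_atomD(4) top_atomD(4) by fastforce
    obtain A where A: "zero_atom A" "x \<in> A" "A \<inter> C = {}" "A \<subseteq> insert x T"
      using zero_atom_cover[of x C] 3 V C(3) exC by auto
    have "excess S T (A \<union> C) \<le> 1" using exC zero_atomD(4)[OF A(1)] by (simp add: excess_Un[OF A(3)])
    moreover have "y \<notin> A \<union> C" using A(4) C(3) 3 less by auto
    ultimately obtain B where B: "zero_atom B" "y \<in> B" "B \<inter> (A \<union> C) = {}"
      using zero_atom_cover[of y "A \<union> C"] 3 V by metis
    have "atom_triple x y i A B C"
      unfolding atom_triple_def using A B C exC by (auto simp: zero_atomD(4))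
    then show ?thesis by blast
  qed
qed

text \<open>One third difference is evaluated twice: as the representative term of the largest
  minimum \<open>i\<close>, and as \<open>- q\<close>. At \<open>i = 3\<close> the left side is the
  default 0.\<close>

lemma rep_coeff:
  assumes q: "common_defect q" and i: "3 \<le> i" "i \<le> n"
  shows "(if 4 \<le> i then g (Rep i) else 0) = - q"
proof -
  have "\<exists>x y. x \<in> {1..n} \<and> y \<in> {1..n} \<and> x < i \<and> y < i \<and> x \<noteq> y
      \<and> (card S = 1 \<longrightarrow> \<not> {x, y, i} \<subseteq> S \<union> T)"
  proof (cases "card S = 1")
    case True
    then obtain u where u: "u \<in> {1, 2, 3}" "u \<notin> S" "u \<notin> T" using free by blast
    show ?thesis
    \<comment> \<open>For \<open>card S = 1\<close> the vertex \<open>u\<close> of condition (iv)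
      has to be among \<open>x\<close>, \<open>y\<close>, \<open>i\<close>. The choice 1, 2 for
      \<open>x\<close>, \<open>y\<close> misses it only if \<open>u = 3 < i\<close>; then 1, 3 is
      taken.\<close>
    proof (cases "u = i \<or> u = 1 \<or> u = 2")
      case True
      then show ?thesis using i u by (intro exI[of _ 1] exI[of _ 2]) auto
    next
      case False
      then show ?thesis using i u by (intro exI[of _ 1] exI[of _ 3]) auto
    qed
  next
    case False
    then show ?thesis using i by (intro exI[of _ 1] exI[of _ 2]) auto
  qed
  then obtain x y where xy: "x \<in> {1..n}" "y \<in> {1..n}" "x < i" "y < i" "x \<noteq> y"
      "card S = 1 \<Longrightarrow> \<not> {x, y, i} \<subseteq> S \<union> T" by blast
  have "\<exists>A B C. atom_triple x y i A B C"
    by (rule ex_atom_triple) (use xy i in auto)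
  then obtain A B C where triple: "atom_triple x y i A B C" by blast
  note t = triple[unfolded atom_triple_def]
  have fin: "finite A" "finite B" "finite C" and ne: "A \<noteq> {}" "B \<noteq> {}" "C \<noteq> {}"
    using t zero_atomD(2,3) top_atomD(2,3) by blast+
  have "Min A \<le> x" "Min B \<le> y" using t fin Min_le by blast+
  then have "Min A < Min C" "Min B < Min C" using t xy by linarith+
  then have "third_difference A B C = (if 4 \<le> Min C then g (Rep (Min C)) else 0)"
    using t fin ne by (intro cluster_weight_third_difference) blast+
  moreover have "third_difference A B C = - q"
    using t by (intro third_difference_atoms[OF q]) blast+
  ultimately show ?thesis using t by simp
qed

text \<open>Vertex 3 shows \<open>q = 0\<close>, so the representative coefficients vanish and the
  edges between two disjoint atoms, not both top atoms, have coefficient sum 0. Small pairs of atoms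
  then determine every edge coefficient from a single one, \<open>\<gamma>\<close>.\<close>

lemma equation_unique: "\<exists>\<gamma>. \<forall>y\<in>coords n. g y = \<gamma> * two_partition_coeff S T y"
proof -
  obtain q where q: "common_defect q" using ex_common_defect by blast
  have "3 \<le> n" using n_ge K by simp
  then have q0: "q = 0" using rep_coeff[OF q, of 3] by simp
  have rep: "g (Rep u) = 0" if "4 \<le> u" "u \<le> n" for u
    using rep_coeff[OF q, of u] that q0 by simp
  define a where "a i j = (if i = j then 0 else g (Edge {i, j}))" for i j
  have a_sym: "a i j = a j i" for i j by (simp add: a_def insert_commute)
  have h_eq: "h X = (\<Sum>i\<in>X. \<Sum>j\<in>X. a i j) / 2" if "X \<subseteq> {1..n}" "X \<noteq> {}" for X
  proof -
    have "Min X \<in> {1..n}" using that Min_in[of X] finite_subset[OF that(1)] by blast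
    then have "Min X \<le> n" by simp
    then show ?thesis by (simp add: cluster_weight_def a_def rep)
  qed
  \<comment> \<open>Without representative terms, \<open>defect A B\<close> is the sum over the
    edges between \<open>A\<close> and \<open>B\<close>.\<close>
  have cross: "(\<Sum>i\<in>A. \<Sum>j\<in>B. a i j) = 0"
    if "zero_atom A \<or> top_atom A" "zero_atom B" "A \<inter> B = {}" for A B
  proof -
    have A: "A \<subseteq> {1..n}" "A \<noteq> {}" "finite A" and B: "B \<subseteq> {1..n}" "B \<noteq> {}" "finite B"
      using that zero_atomD(1-3) top_atomD(1-3) by blast+
    have "(\<Sum>i\<in>B. \<Sum>j\<in>A. a i j) = (\<Sum>i\<in>A. \<Sum>j\<in>B. a i j)"
      by (subst sum.swap) (simp add: a_sym)
    moreover have "defect A B = 0" using q q0 that unfolding common_defect_def by blast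
    ultimately show ?thesis
      using A B that(3) by (simp add: h_eq sum.union_disjoint sum.distrib field_simps)
  qed
  \<comment> \<open>Singletons now have weight 0, so \<open>weight_swap\<close> compares just the
    two edges at \<open>s\<close>.\<close>
  have st: "a s t' = a s t" if "s \<in> S" "t \<in> T" "t' \<in> T" "t \<noteq> t'" for s t t'
  proof -
    have in_V: "s \<in> {1..n}" "t \<in> {1..n}" "t' \<in> {1..n}" using that S T by blast+
    have ne: "s \<noteq> t" "s \<noteq> t'" using that S_neq_T by blast+
    have diag: "a i i = 0" for i by (simp add: a_def)
    have "h {i} = 0" "i \<noteq> j \<Longrightarrow> h {i, j} = a i j" if "i \<in> {1..n}" "j \<in> {1..n}" for i j
      using that by (simp_all add: h_eq diag a_sym[of j i])
    then show ?thesis using weight_swap[OF that] in_V ne by simp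
  qed
  have tt: "a t t' = - a s t" if "s \<in> S" "t \<in> T" "t' \<in> T" "t \<noteq> t'" for s t t'
    using cross[of "{t}" "{s, t'}"] that S_neq_T[of s] a_sym[of t s]
    by (simp add: top_atomI zero_atomI)
  have tu: "a t u = 0" if "t \<in> T" "u \<in> {1..n}" "u \<notin> S" "u \<notin> T" for t u
    using cross[of "{t}" "{u}"] that by (auto simp: top_atomI zero_atomI)
  have uu: "a u u' = 0"
    if "u \<in> {1..n}" "u \<notin> S" "u \<notin> T" "u' \<in> {1..n}" "u' \<notin> S" "u' \<notin> T" for u u'
    using cross[of "{u}" "{u'}"] that by (cases "u = u'") (auto simp: zero_atomI a_def)
  have us: "a u s = 0" if "u \<in> {1..n}" "u \<notin> S" "u \<notin> T" "s \<in> S" for u s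
  proof -
    obtain t where t: "t \<in> T" using T by blast
    then have "a u s + a u t = 0"
      using cross[of "{u}" "{s, t}"] that S_neq_T[of s t] by (auto simp: zero_atomI)
    then show ?thesis using tu[OF t, of u] that a_sym[of u t] by simp
  qed
  obtain s0 where s0: "s0 \<in> S" using S by blast
  obtain t0 where t0: "t0 \<in> T" using T by blast
  define \<gamma> where "\<gamma> = a s0 t0"
  have other: "\<exists>t'\<in>T. t' \<noteq> t" for t
    using ex_fresh[of "{t}" T] S_less card_S_pos by auto
  \<comment> \<open>Independence of \<open>s\<close>: both \<open>a s t0\<close> and
    \<open>a s0 t0\<close> are the negative of \<open>a t0 t'\<close>.\<close>
  have ST: "a s t = \<gamma>" if "s \<in> S" "t \<in> T" for s t
  proof -
    have "a s t = a s t0" using st[of s t t0] that t0 by (cases "t = t0") auto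
    moreover obtain t' where "t' \<in> T" "t' \<noteq> t0" using other by blast
    ultimately show ?thesis
      using tt[of s t0 t'] tt[of s0 t0 t'] that s0 t0 by (simp add: \<gamma>_def)
  qed
  have TT: "a t t' = - \<gamma>" if "t \<in> T" "t' \<in> T" "t \<noteq> t'" for t t'
    using tt[OF s0 that] ST[OF s0 that(1)] by simp
  have SS: "a s s' = - \<gamma>" if "s \<in> S" "s' \<in> S" "s \<noteq> s'" for s s'
  proof -
    obtain t' where t': "t' \<in> T" "t' \<noteq> t0" using other by blast
    \<comment> \<open>Of the four edges between the two pairs, two have coefficient
      \<open>\<gamma>\<close> and one has \<open>- \<gamma>\<close>, which leaves
      \<open>- \<gamma>\<close> for \<open>a s s'\<close>.\<close>
    have "a s s' + a s t' + (a t0 s' + a t0 t') = 0"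
      using cross[of "{s, t0}" "{s', t'}"] that t0 t' S_neq_T[of s] S_neq_T[of s']
      by (auto simp: zero_atomI)
    then show ?thesis
      using ST[of s t'] ST[of s' t0] TT[of t0 t'] a_sym[of t0 s'] that t0 t' by simp
  qed
  have "g (Edge {i, j}) = \<gamma> * two_partition_coeff S T (Edge {i, j})"
    if ij: "i \<in> {1..n}" "j \<in> {1..n}" "i \<noteq> j" for i j
  proof -
    have "a i j = - \<gamma> * (side_sign S T i * side_sign S T j)"
      using ij ST[of i j] ST[of j i] TT[of i j] SS[of i j] uu[of i j] tu[of i j] tu[of j i]
        us[of i j] us[of j i] a_sym[of i j] S_neq_T[of i i] S_neq_T[of j j]
      by (auto simp: side_sign_def)
    then show ?thesis using ij by (simp add: a_def)
  qed
  moreover have "g (Rep u) = \<gamma> * two_partition_coeff S T (Rep u)" if "u \<in> {4..n}" for u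
    using rep that by simp
  ultimately show ?thesis by (metis coords_cases)
qed

end

subsection \<open>Necessity of the conditions\<close>

definition edge_indicator :: "nat \<Rightarrow> nat \<Rightarrow> coord \<Rightarrow> real" where
  "edge_indicator i j y = of_bool (y = Edge {i, j})"

lemma cluster_weight_edge_indicator:
  assumes "finite C" "i \<noteq> j"
  shows "cluster_weight (edge_indicator i j) C = of_bool (i \<in> C \<and> j \<in> C)"
proof -
  have "(\<Sum>x\<in>C. \<Sum>y\<in>C. if x = y then 0 else edge_indicator i j (Edge {x, y}))
      = (\<Sum>x\<in>C. \<Sum>y\<in>C. (if x = i then of_bool (y = j) else 0)
          + (if x = j then of_bool (y = i) else 0))"
    using assms(2) by (intro sum.cong refl) (auto simp: edge_indicator_def doubleton_eq_iff)
  also have "\<dots> = (\<Sum>x\<in>C. if x = i then of_bool (j \<in> C) else 0)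
      + (\<Sum>x\<in>C. if x = j then of_bool (i \<in> C) else 0)"
  proof -
    have "(\<Sum>y\<in>C. if x = u then of_bool (y = v) else 0) = (if x = u then of_bool (v \<in> C) else (0::real))"
      for x u v :: nat
      using assms(1) by (simp add: of_bool_def)
    then show ?thesis by (simp only: sum.distrib)
  qed
  also have "\<dots> = 2 * of_bool (i \<in> C \<and> j \<in> C)"
    using assms(1) by simp
  finally show ?thesis by (simp add: cluster_weight_def edge_indicator_def)
qed

lemma cluster_weight_add:
  "cluster_weight (\<lambda>y. f y + g y) C = cluster_weight f C + cluster_weight g C"
proof -
  have "(\<Sum>i\<in>C. \<Sum>j\<in>C. if i = j then 0 else f (Edge {i, j}) + g (Edge {i, j}))
    = (\<Sum>i\<in>C. \<Sum>j\<in>C. (if i = j then 0 else f (Edge {i, j}))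
      + (if i = j then 0 else g (Edge {i, j})))"
    by (intro sum.cong refl) simp
  then show ?thesis by (simp add: cluster_weight_def sum.distrib add_divide_distrib)
qed

lemma cluster_weight_scale: "cluster_weight (\<lambda>y. a * f y) C = a * cluster_weight f C"
proof -
  have "(\<Sum>i\<in>C. \<Sum>j\<in>C. if i = j then 0 else a * f (Edge {i, j}))
    = a * (\<Sum>i\<in>C. \<Sum>j\<in>C. if i = j then 0 else f (Edge {i, j}))"
    unfolding sum_distrib_left by (intro sum.cong refl) simp
  then show ?thesis by (simp add: cluster_weight_def distrib_left)
qed

fun rep_count :: "coord \<Rightarrow> real" where
  "rep_count (Edge e) = 0"
| "rep_count (Rep u) = 1"

lemma cluster_weight_rep_count: "cluster_weight rep_count C = of_bool (4 \<le> Min C)"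
  by (simp add: cluster_weight_def cong: if_cong)

text \<open>All representative variables, with those of 1, 2, 3 included, add up to
  \<open>K\<close>, and 1 is always a representative. Where the edges among 1, 2, 3 determine
  linearly whether 2 and 3 are representatives, an equation of this shape results; this happens for
  \<open>K = 2\<close> and when condition (iv) fails.\<close>

definition small_triangle :: "real \<Rightarrow> real \<Rightarrow> real \<Rightarrow> coord \<Rightarrow> real" where
  "small_triangle a b c = (\<lambda>y. rep_count y + (a * edge_indicator 1 2 y
    + (b * edge_indicator 1 3 y + c * edge_indicator 2 3 y)))"

lemma cluster_weight_small_triangle:
  assumes "C \<subseteq> {1..n}" "C \<noteq> {}"
  shows "cluster_weight (small_triangle a b c) C
    = of_bool (1 \<notin> C \<and> 2 \<notin> C \<and> 3 \<notin> C) + (a * of_bool (1 \<in> C \<and> 2 \<in> C)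
      + (b * of_bool (1 \<in> C \<and> 3 \<in> C) + c * of_bool (2 \<in> C \<and> 3 \<in> C)))"
proof -
  have fin: "finite C" using assms(1) finite_subset by auto
  have "4 \<le> Min C \<longleftrightarrow> (\<forall>x\<in>C. 4 \<le> x)" using fin assms(2) by simp
  also have "\<dots> \<longleftrightarrow> 1 \<notin> C \<and> 2 \<notin> C \<and> 3 \<notin> C"
  proof
    assume out: "1 \<notin> C \<and> 2 \<notin> C \<and> 3 \<notin> C"
    show "\<forall>x\<in>C. 4 \<le> x"
    proof
      fix x assume x: "x \<in> C"
      then have "x \<noteq> 1" "x \<noteq> 2" "x \<noteq> 3" "1 \<le> x" using out assms(1) by auto
      then show "4 \<le> x" by linarith
    qed
  qed auto
  finally show ?thesis
    by (simp only: small_triangle_def cluster_weight_add cluster_weight_scale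
        cluster_weight_rep_count) (simp add: cluster_weight_edge_indicator[OF fin])
qed

text \<open>With at most one cluster, the variable of the edge \<open>{1, 2}\<close> equals 1 on all
  partitions.\<close>

lemma full_dimensional_K_ge_2:
  assumes idx: "bij_betw idx (coords n) (UNIV :: 'c::finite set)"
    and full: "full_dimensional (partition_polytope idx n K)" and n: "2 \<le> n"
  shows "2 \<le> K"
proof (rule ccontr)
  assume "\<not> 2 \<le> K"
  then have K: "K \<le> 1" by simp
  have "(\<Sum>C\<in>\<pi>. cluster_weight (edge_indicator 1 2) C) = 1" if \<pi>: "K_partition n K \<pi>" for \<pi>
  proof -
    note p = K_partitionD[OF \<pi>]
    have "\<pi> \<noteq> {}" using p(1) n by auto
    then have "card \<pi> \<noteq> 0" using p(2) by simp
    then have "card \<pi> = 1" using K p(3) by linarith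
    then obtain C where C: "\<pi> = {C}" by (auto simp: card_1_singleton_iff)
    then have "C = {1..n}" using p(1) by simp
    moreover have "1 \<in> {1..n}" "2 \<in> {1..n}" using n by auto
    ultimately show ?thesis
      using C cluster_weight_edge_indicator[of "{1..n}" 1 2] by simp
  qed
  then have "edge_indicator 1 2 (Edge {1, 2}) = 0"
    using n by (intro full_dimensional_no_equation[OF idx full] Edge_in_coords) auto
  then show False by (simp add: edge_indicator_def)
qed

text \<open>
  For \<open>K = 2\<close>, a cluster with \<open>k\<close> of the vertices 1, 2, 3 has weight
  \<open>[k = 0] - k (k - 1) / 4\<close>, and both \<open>k = 0, 3\<close> and \<open>k = 1, 2\<close> add up to \<open>- 1 / 2\<close>.
\<close>

lemma full_dimensional_K_neq_2:
  assumes idx: "bij_betw idx (coords n) (UNIV :: 'c::finite set)"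
    and full: "full_dimensional (partition_polytope idx n K)" and n: "3 \<le> n"
  shows "K \<noteq> 2"
proof
  assume K: "K = 2"
  let ?g = "small_triangle (- 1 / 2) (- 1 / 2) (- 1 / 2)"
  have "(\<Sum>C\<in>\<pi>. cluster_weight ?g C) = - 1 / 2" if \<pi>: "K_partition n K \<pi>" for \<pi>
  proof -
    note p = K_partitionD[OF \<pi>]
    obtain C D where CD: "\<pi> = {C, D}" "C \<noteq> D" using p(3) K by (auto simp: card_2_iff)
    have mem: "x \<in> D \<longleftrightarrow> x \<notin> C" if "x \<in> {1..n}" for x
    proof -
      have "x \<in> C \<or> x \<in> D" using that CD(1) p(1) by blast
      moreover have "\<not> (x \<in> C \<and> x \<in> D)" using CD p(5) by blast
      ultimately show ?thesis by blast
    qed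
    have m: "1 \<in> D \<longleftrightarrow> 1 \<notin> C" "2 \<in> D \<longleftrightarrow> 2 \<notin> C" "3 \<in> D \<longleftrightarrow> 3 \<notin> C"
      by (rule mem; use n in simp)+
    have w: "cluster_weight ?g X
      = of_bool (1 \<notin> X \<and> 2 \<notin> X \<and> 3 \<notin> X) + (- 1 / 2 * of_bool (1 \<in> X \<and> 2 \<in> X)
        + (- 1 / 2 * of_bool (1 \<in> X \<and> 3 \<in> X) + - 1 / 2 * of_bool (2 \<in> X \<and> 3 \<in> X)))"
      if "X \<in> \<pi>" for X
      by (rule cluster_weight_small_triangle) (use p(4)[OF that] in auto)
    have "(\<Sum>C\<in>\<pi>. cluster_weight ?g C) = cluster_weight ?g C + cluster_weight ?g D"
      using CD by simp
    also have "\<dots> = - 1 / 2"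
    proof -
      have "C \<in> \<pi>" "D \<in> \<pi>" using CD(1) by auto
      then show ?thesis
        unfolding w[OF \<open>C \<in> \<pi>\<close>] w[OF \<open>D \<in> \<pi>\<close>] m
        by (cases "1 \<in> C"; cases "2 \<in> C"; cases "3 \<in> C") simp_all
    qed
    finally show ?thesis .
  qed
  then have "?g (Edge {1, 2}) = 0"
    using n by (intro full_dimensional_no_equation[OF idx full] Edge_in_coords) auto
  then show False by (simp add: small_triangle_def edge_indicator_def doubleton_eq_iff)
qed

context vertex_pair
begin

lemma sum_excess:
  assumes "K_partition n K \<pi>"
  shows "(\<Sum>C\<in>\<pi>. excess S T C) = int (card T) - int (card S)"
  using sum_card_Int_K_partition[OF assms S(1)] sum_card_Int_K_partition[OF assms T(1)]
  by (simp add: excess_def sum_subtractf flip: of_nat_sum)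

lemma balanced_Diff_nonempty:
  assumes "balanced C" "finite C" "C \<noteq> {}"
  shows "1 \<le> card (C - S)"
proof -
  have "\<not> C \<subseteq> S"
  proof
    assume "C \<subseteq> S"
    then have "S \<inter> C = C" "T \<inter> C = {}" using disj by blast+
    then show False using assms by (simp add: excess_def card_gt_0_iff)
  qed
  then show ?thesis using assms(2) by (simp add: Suc_le_eq card_gt_0_iff)
qed

lemma balanced_member_T:
  assumes "balanced C" "s \<in> S" "s \<in> C"
  shows "\<exists>t\<in>T. t \<in> C"
proof -
  have "0 < card (S \<inter> C)" using assms finite_ST by (auto simp: card_gt_0_iff)
  then have "0 < card (T \<inter> C)" using assms(1) by (auto simp: excess_def)
  then show ?thesis by (auto simp: card_gt_0_iff)
qed

lemma balanced_two_T:
  assumes "balanced C" "t \<in> T" "t' \<in> T" "t \<noteq> t'" "t \<in> C" "t' \<in> C"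
  shows "\<exists>s\<in>S. s \<in> C"
proof -
  have "card {t, t'} \<le> card (T \<inter> C)" using assms finite_ST by (intro card_mono) auto
  then have "0 < card (S \<inter> C)" using assms(1,4) by (auto simp: excess_def)
  then show ?thesis by (auto simp: card_gt_0_iff)
qed

end

section \<open>A second equation for each condition that fails\<close>

locale facet_necessity = vertex_pair +
  fixes K :: nat and \<pi>\<^sub>0 :: "nat set set"
  assumes tight0: "tight K \<pi>\<^sub>0" and K: "2 \<le> K"
    and unique: "\<And>g d. (\<And>\<pi>. tight K \<pi> \<Longrightarrow> (\<Sum>C\<in>\<pi>. cluster_weight g C) = d) \<Longrightarrow>
      \<exists>\<gamma>. \<forall>y\<in>coords n. g y = \<gamma> * two_partition_coeff S T y"
begin

lemma tightD:
  assumes "tight K \<pi>"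
  shows "K_partition n K \<pi>" "\<And>C. C \<in> \<pi> \<Longrightarrow> balanced C"
  using assms by (auto simp: tight_def)

text \<open>Second equations are given cluster by cluster below; \<open>w\<close> is the simpler
  form that the weight takes on clusters of tight partitions.\<close>

lemma unique':
  assumes "\<And>\<pi> C. tight K \<pi> \<Longrightarrow> C \<in> \<pi> \<Longrightarrow> C \<subseteq> {1..n} \<Longrightarrow> finite C \<Longrightarrow> C \<noteq> {} \<Longrightarrow> balanced C
      \<Longrightarrow> cluster_weight g C = w C"
    and "\<And>\<pi>. tight K \<pi> \<Longrightarrow> (\<Sum>C\<in>\<pi>. w C) = d"
  obtains \<gamma> where "\<And>y. y \<in> coords n \<Longrightarrow> g y = \<gamma> * two_partition_coeff S T y"
proof -
  have "(\<Sum>C\<in>\<pi>. cluster_weight g C) = d" if "tight K \<pi>" for \<pi>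
  proof -
    have "(\<Sum>C\<in>\<pi>. cluster_weight g C) = (\<Sum>C\<in>\<pi>. w C)"
      using that tightD[OF that] K_partitionD(4)[OF tightD(1)[OF that]]
      by (intro sum.cong refl assms(1)[OF that]) blast+
    then show ?thesis using assms(2)[OF that] by simp
  qed
  from unique[OF this] show ?thesis using that by blast
qed

lemma excess_bounds:
  "0 \<le> int (card T) - int (card S)" "int (card T) - int (card S) \<le> int K"
proof -
  note p = K_partitionD[OF tightD(1)[OF tight0]]
  have "0 \<le> (\<Sum>C\<in>\<pi>\<^sub>0. excess S T C)" "(\<Sum>C\<in>\<pi>\<^sub>0. excess S T C) \<le> (\<Sum>C\<in>\<pi>\<^sub>0. 1)"
    using tightD(2)[OF tight0] by (intro sum_nonneg sum_mono; force)+
  then show "0 \<le> int (card T) - int (card S)" "int (card T) - int (card S) \<le> int K"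
    using p(3) by (simp_all add: sum_excess[OF tightD(1)[OF tight0]])
qed

lemma coeff_ST: "s \<in> S \<Longrightarrow> t \<in> T \<Longrightarrow> two_partition_coeff S T (Edge {s, t}) = 1"
  using S_neq_T[of s t] disj by (auto simp: side_sign_def)

lemma Edge_ST: "s \<in> S \<Longrightarrow> t \<in> T \<Longrightarrow> Edge {s, t} \<in> coords n"
  using S_neq_T[of s t] S T by (intro Edge_in_coords) auto

text \<open>
  If all clusters of tight partitions have the same excess, the equation saying so for the
  cluster of a single vertex of \<open>T\<close> is a second equation.
\<close>

lemma not_constant_excess:
  assumes const: "\<And>\<pi> C. tight K \<pi> \<Longrightarrow> C \<in> \<pi> \<Longrightarrow> excess S T C = c"
    and large: "3 \<le> card (S \<union> T)"
  shows False
proof -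
  obtain s where s: "s \<in> S" using S by blast
  obtain t where t: "t \<in> T" using T by blast
  define g where "g y = (case y of Edge e \<Rightarrow> if t \<in> e then two_partition_coeff S T y else 0
    | Rep u \<Rightarrow> 0)" for y
  have \<sigma>t: "side_sign S T t = - 1" using t S_neq_T by (auto simp: side_sign_def)
  \<comment> \<open>In the cluster of \<open>t\<close>, the signs of the other vertices add up to
    \<open>1 - c\<close>, since all signs add up to \<open>- c\<close> and that of \<open>t\<close>
    is -1.\<close>
  have weight: "cluster_weight g C = (if t \<in> C then 1 - of_int c else 0)"
    if "tight K \<pi>" "C \<in> \<pi>" "finite C" for \<pi> C
  proof -
    define f where "f i = (if i = t then 0 else side_sign S T i)" for i
    have entry: "(if i = j then 0 else g (Edge {i, j}))
        = (if i = t then f j else 0) + (if j = t then f i else 0)" for i j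
      using \<sigma>t by (auto simp: g_def f_def)
    have "(\<Sum>i\<in>C. f i) = (\<Sum>i\<in>C - {t}. side_sign S T i)"
      by (rule sum.mono_neutral_cong_right) (use \<open>finite C\<close> in \<open>auto simp: f_def\<close>)
    also have "\<dots> = (\<Sum>i\<in>C. side_sign S T i) - (if t \<in> C then side_sign S T t else 0)"
      using \<open>finite C\<close> by (simp add: sum_diff1)
    also have "\<dots> = (if t \<in> C then 1 - of_int c else - of_int c)"
      using sum_side_sign[OF \<open>finite C\<close> disj] const[OF that(1,2)] \<sigma>t by simp
    finally have sum_f: "(\<Sum>i\<in>C. f i) = (if t \<in> C then 1 - of_int c else - of_int c)" .
    have inner: "(\<Sum>j\<in>C. if i = t then f j else 0) = (if i = t then \<Sum>j\<in>C. f j else 0)"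
      "(\<Sum>j\<in>C. if j = t then f i else 0) = (if t \<in> C then f i else 0)" for i
      using \<open>finite C\<close> by simp_all
    have "(\<Sum>i\<in>C. \<Sum>j\<in>C. if i = j then 0 else g (Edge {i, j}))
        = (if t \<in> C then 2 * (1 - of_int c) else 0)"
      unfolding entry sum.distrib inner using \<open>finite C\<close> sum_f by simp
    then show ?thesis by (simp add: cluster_weight_def g_def)
  qed
  have "(\<Sum>C\<in>\<pi>. if t \<in> C then 1 - of_int c else (0::real)) = 1 - of_int c"
    if "tight K \<pi>" for \<pi>
  proof -
    note p = K_partitionD[OF tightD(1)[OF that]]
    obtain C where C: "C \<in> \<pi>" "t \<in> C" using p(1) t T by blast
    have "(\<Sum>C\<in>\<pi>. if t \<in> C then 1 - of_int c else (0::real))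
        = (\<Sum>D\<in>\<pi>. if D = C then 1 - of_int c else 0)"
      using C p(5) by (intro sum.cong refl) auto
    then show ?thesis using C p(2) by simp
  qed
  then obtain \<gamma> where \<gamma>: "\<And>y. y \<in> coords n \<Longrightarrow> g y = \<gamma> * two_partition_coeff S T y"
    using unique'[of g "\<lambda>C. if t \<in> C then 1 - of_int c else 0" "1 - of_int c"] weight by metis
  have "g (Edge {s, t}) = two_partition_coeff S T (Edge {s, t})" by (simp add: g_def)
  then have "\<gamma> = 1" using \<gamma>[OF Edge_ST[OF s t]] coeff_ST[OF s t]
    by (simp del: two_partition_coeff.simps)
  \<comment> \<open>A third vertex of \<open>S \<union> T\<close> tells the equations apart: the
    edge \<open>{s, v}\<close> avoids \<open>t\<close> but has a nonzero coefficient in the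
    inequality.\<close>
  obtain v where v: "v \<in> S \<union> T" "v \<notin> {s, t}"
    using ex_fresh[of "{s, t}" "S \<union> T"] large S_neq_T[OF s t] by auto
  then have "Edge {s, v} \<in> coords n" using s S T by (intro Edge_in_coords) auto
  moreover have "g (Edge {s, v}) = 0" using v S_neq_T[OF s t] by (auto simp: g_def)
  moreover have "two_partition_coeff S T (Edge {s, v}) \<noteq> 0"
    using v s by (auto simp: side_sign_def)
  ultimately show False using \<gamma> \<open>\<gamma> = 1\<close> by simp
qed

text \<open>At the extreme differences \<open>K\<close> and 0, every cluster of a tight partition
  has excess 1 or 0, respectively, and \<open>not_constant_excess\<close> applies if
  \<open>S \<union> T\<close> has at least three vertices. What remains is
  \<open>card S = card T = 1\<close>.\<close>

lemma excess_in_range: "int (card T) - int (card S) \<in> {1..int K - 1}"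
proof -
  have pos: "1 \<le> card S" "1 \<le> card T"
    using S T finite_ST by (simp_all add: Suc_leI card_gt_0_iff)
  have union: "card (S \<union> T) = card S + card T"
    using finite_ST disj by (simp add: card_Un_disjoint)
  have "int (card T) - int (card S) \<noteq> int K"
  proof
    assume D: "int (card T) - int (card S) = int K"
    have "excess S T C = 1" if "tight K \<pi>" "C \<in> \<pi>" for \<pi> C
    proof (rule ccontr)
      assume ne: "excess S T C \<noteq> 1"
      note p = K_partitionD[OF tightD(1)[OF that(1)]]
      have le: "excess S T D \<le> 1" if "D \<in> \<pi>" for D
        using tightD(2)[OF \<open>tight K \<pi>\<close> that] by auto
      then have "excess S T C < 1" using ne \<open>C \<in> \<pi>\<close> by fastforce
      then have "(\<Sum>C\<in>\<pi>. excess S T C) < (\<Sum>C\<in>\<pi>. 1)"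
        using le p(2) \<open>C \<in> \<pi>\<close> by (intro sum_strict_mono_ex1) auto
      then show False using D p(3) by (simp add: sum_excess[OF tightD(1)[OF that(1)]])
    qed
    then show False using D union pos K by (intro not_constant_excess[of 1]) auto
  qed
  moreover have "int (card T) - int (card S) \<noteq> 0"
  proof
    assume D: "int (card T) - int (card S) = 0"
    have ex0: "excess S T C = 0" if "tight K \<pi>" "C \<in> \<pi>" for \<pi> C
    proof -
      note p = K_partitionD[OF tightD(1)[OF that(1)]]
      have "0 \<le> excess S T D" if "D \<in> \<pi>" for D
        using tightD(2)[OF \<open>tight K \<pi>\<close> that] by auto
      then show ?thesis
        using D p(2) that(2) sum_excess[OF tightD(1)[OF that(1)]]
        by (metis (no_types, lifting) sum_nonneg_eq_0_iff)
    qed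
    then have "\<not> 3 \<le> card (S \<union> T)" using not_constant_excess by blast
    then have "card S = 1" "card T = 1" using D union pos by auto
    then obtain s t where st: "S = {s}" "T = {t}" by (auto simp: card_1_singleton_iff)
    then have "s \<noteq> t" using disj by auto
    note p = K_partitionD[OF tightD(1)[OF tight0]]
    obtain C where C: "C \<in> \<pi>\<^sub>0" "s \<in> C" using p(1) S st by blast
    have same: "s \<in> D \<longleftrightarrow> t \<in> D" if "tight K \<pi>" "D \<in> \<pi>" for \<pi> D
      using ex0[OF that] st by (auto simp: excess_def Int_insert_left split: if_splits)
    have "\<not> \<pi>\<^sub>0 \<subseteq> {C}" using p(3) K card_mono[of "{C}" \<pi>\<^sub>0] by auto
    then obtain D where D: "D \<in> \<pi>\<^sub>0" "D \<noteq> C" by blast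
    then obtain u where u: "u \<in> D" "u \<in> {1..n}" using p(4) by blast
    then have us: "u \<noteq> s" "u \<noteq> t" using p(5) C D same[OF tight0 C(1)] by blast+
    \<comment> \<open>\<open>s\<close> and \<open>t\<close> always share a cluster, so the edges
      from \<open>u\<close> to them have equal values.\<close>
    define g where "g y = edge_indicator s u y + (- 1) * edge_indicator t u y" for y
    have "cluster_weight g C = 0" if "tight K \<pi>" "C \<in> \<pi>" "finite C" for \<pi> C
      unfolding g_def cluster_weight_add cluster_weight_scale
      using us same[OF that(1,2)] by (simp add: cluster_weight_edge_indicator[OF that(3)])
    then obtain \<gamma> where \<gamma>: "\<And>y. y \<in> coords n \<Longrightarrow> g y = \<gamma> * two_partition_coeff S T y"
      using unique'[of g "\<lambda>_. 0" 0] by (metis sum.neutral_const)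
    have "Edge {s, u} \<in> coords n" using u us S st by (intro Edge_in_coords) auto
    moreover have "g (Edge {s, u}) = 1"
      using us \<open>s \<noteq> t\<close> by (auto simp: g_def edge_indicator_def doubleton_eq_iff)
    moreover have "two_partition_coeff S T (Edge {s, u}) = 0"
      using us st by (auto simp: side_sign_def)
    ultimately show False using \<gamma>[of "Edge {s, u}"] by (simp del: two_partition_coeff.simps)
  qed
  ultimately show ?thesis using excess_bounds by simp
qed

lemma card_T_ge_2: "2 \<le> card T"
  using card_S_pos excess_in_range by auto

text \<open>
  Every cluster of a tight partition meets \<open>V - S\<close>. If \<open>V - S\<close> has at most \<open>K + 1\<close> elements,
  at most one pair of them shares a cluster, so the number of such pairs is \<open>|V - S| - K\<close>.
\<close>

lemma card_S_bound: "int (card S) \<le> int n - (int K + 2)"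
proof (rule ccontr)
  assume "\<not> ?thesis"
  then have few: "n \<le> card S + K + 1" by simp
  have cardV: "card ({1..n} - S) = n - card S"
    using S finite_ST by (simp add: card_Diff_subset)
  have le_n: "card S \<le> n" using card_mono[OF _ S(1)] by simp
  define g :: "coord \<Rightarrow> real" where "g y = (case y of Edge e \<Rightarrow> of_bool (e \<inter> S = {}) | Rep u \<Rightarrow> 0)" for y
  have sum: "(\<Sum>C\<in>\<pi>. int (card (C - S)) - 1) = int n - int (card S) - int K"
    and small: "\<And>C. C \<in> \<pi> \<Longrightarrow> card (C - S) \<in> {1, 2}" if \<pi>: "tight K \<pi>" for \<pi>
  proof -
    note p = K_partitionD[OF tightD(1)[OF \<pi>]]
    have "(\<Sum>C\<in>\<pi>. card (C - S)) = (\<Sum>C\<in>\<pi>. card (({1..n} - S) \<inter> C))"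
      using p(4) by (intro sum.cong refl arg_cong[where f=card]) blast
    also have "\<dots> = n - card S"
      using sum_card_Int_K_partition[OF tightD(1)[OF \<pi>], of "{1..n} - S"] cardV by simp
    finally show *: "(\<Sum>C\<in>\<pi>. int (card (C - S)) - 1) = int n - int (card S) - int K"
      using p(3) le_n by (simp add: sum_subtractf of_nat_diff flip: of_nat_sum)
    fix C assume C: "C \<in> \<pi>"
    have pos: "1 \<le> card (D - S)" if "D \<in> \<pi>" for D
      using balanced_Diff_nonempty[OF tightD(2)[OF \<pi> that]] p(4)[OF that] by blast
    have "int (card (C - S)) - 1 \<le> (\<Sum>C\<in>\<pi>. int (card (C - S)) - 1)"
    proof (rule member_le_sum[OF C])
      show "0 \<le> int (card (D - S)) - 1" if "D \<in> \<pi> - {C}" for D using pos[of D] that by simp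
    qed (rule p(2))
    then show "card (C - S) \<in> {1, 2}" using * few pos[OF C] by auto
  qed
  have "cluster_weight g C = of_int (int (card (C - S)) - 1)"
    if "tight K \<pi>" "C \<in> \<pi>" "finite C" for \<pi> C
  proof -
    have "(\<Sum>i\<in>C. \<Sum>j\<in>C. if i = j then 0 else g (Edge {i, j}))
        = (\<Sum>i\<in>C - S. \<Sum>j\<in>C - S. if i = j then 0 else 1)"
    proof (rule sum.mono_neutral_cong_right)
      show "\<forall>i\<in>C - (C - S). (\<Sum>j\<in>C. if i = j then 0 else g (Edge {i, j})) = 0"
      proof
        fix i assume "i \<in> C - (C - S)"
        then have "g (Edge {i, j}) = 0" for j by (simp add: g_def)
        then show "(\<Sum>j\<in>C. if i = j then 0 else g (Edge {i, j})) = 0" by (simp cong: if_cong)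
      qed
      show "(\<Sum>j\<in>C. if i = j then 0 else g (Edge {i, j})) = (\<Sum>j\<in>C - S. if i = j then 0 else 1)"
        if "i \<in> C - S" for i
        by (rule sum.mono_neutral_cong_right) (use that \<open>finite C\<close> in \<open>auto simp: g_def\<close>)
    qed (use \<open>finite C\<close> in auto)
    \<comment> \<open>The number of pairs among \<open>m\<close> vertices equals
      \<open>m - 1\<close> only for \<open>m = 1\<close> and \<open>m = 2\<close>, which is why
      \<open>small\<close> is needed.\<close>
    moreover have "card (C - S) = 1 \<or> card (C - S) = 2" using small[OF that(1,2)] by blast
    then have "(\<Sum>i\<in>C - S. \<Sum>j\<in>C - S. if i = j then 0 else (1::real))
        = 2 * (real (card (C - S)) - 1)"
      by (elim disjE) (auto simp: card_1_singleton_iff card_2_iff)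
    ultimately show ?thesis by (simp add: cluster_weight_def g_def)
  qed
  moreover have "(\<Sum>C\<in>\<pi>. of_int (int (card (C - S)) - 1)) = (of_int (int n - int (card S) - int K) :: real)"
    if "tight K \<pi>" for \<pi>
    using sum[OF that] by (simp only: of_int_sum[symmetric])
  ultimately obtain \<gamma> where \<gamma>: "\<And>y. y \<in> coords n \<Longrightarrow> g y = \<gamma> * two_partition_coeff S T y"
    using unique'[of g "\<lambda>C. of_int (int (card (C - S)) - 1)"] by metis
  obtain s where s: "s \<in> S" using S by blast
  obtain t where t: "t \<in> T" using T by blast
  obtain t' where t': "t' \<in> T" "t' \<noteq> t" using ex_fresh[of "{t}" T] card_T_ge_2 by auto
  \<comment> \<open>\<open>g\<close> vanishes between \<open>S\<close> and \<open>T\<close>, which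
    forces the factor 0, but it does not vanish inside \<open>T\<close>.\<close>
  have "g (Edge {s, t}) = 0" using s by (simp add: g_def)
  then have "\<gamma> = 0" using \<gamma>[OF Edge_ST[OF s t]] coeff_ST[OF s t]
    by (simp del: two_partition_coeff.simps)
  moreover have "g (Edge {t, t'}) = 1" using t t' disj by (auto simp: g_def)
  moreover have "Edge {t, t'} \<in> coords n" using t t' T by (intro Edge_in_coords) auto
  ultimately show False using \<gamma>[of "Edge {t, t'}"] by simp
qed

lemma n_ge_5: "5 \<le> n"
  using card_S_pos card_S_bound K by linarith

text \<open>
  If \<open>S = {s}\<close> and \<open>{1, 2, 3} \<subseteq> S \<union> T\<close>, then in a tight partition 1, 2, 3 share a cluster
  exactly if \<open>s\<close> is among them and the other two do. Hence the variable of vertex 3 is a linear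
  function of the edge variables, and so is the sum of the remaining representative variables.
\<close>

lemma free_small_vertex:
  assumes "card S = 1"
  shows "\<exists>u\<in>{1, 2, 3}. u \<notin> S \<and> u \<notin> T"
proof (rule ccontr)
  assume "\<not> ?thesis"
  then have in_ST: "1 \<in> S \<union> T" "2 \<in> S \<union> T" "3 \<in> S \<union> T" by auto
  obtain s where s: "S = {s}" using assms by (auto simp: card_1_singleton_iff)
  have in_T: "i \<in> T \<longleftrightarrow> i \<noteq> s" if "i \<in> {1, 2, 3}" for i
    using in_ST that s disj by (metis UnE Un_iff disjoint_iff insertE insert_iff singletonD)
  \<comment> \<open>\<open>a k\<close> is the coefficient of the triangle edge opposite to
    \<open>k\<close>. The edge opposite to \<open>s\<close> is dropped; if \<open>s\<close> is not
    among 1, 2, 3, all three edges are kept.\<close>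
  define a where "a i = (if s = i then 0 else - 1 :: real)" for i :: nat
  define g where "g = small_triangle (a 3) (a 2) (a 1)"
  \<comment> \<open>With \<open>k\<close> of the vertices 1, 2, 3 in \<open>C\<close>, the weight is
    1, 0, -1, -2 for \<open>k = 0, 1, 2, 3\<close>. Two vertices of \<open>T\<close> in
    \<open>C\<close> bring \<open>s\<close> along, so the dropped edge occurs only in a full
    triangle, and a full triangle contains \<open>s\<close>.\<close>
  have weight: "cluster_weight g C = 1 - real (card ({1, 2, 3} \<inter> C))"
    if C: "C \<subseteq> {1..n}" "C \<noteq> {}" "balanced C" for C
  proof -
    have two: "s \<in> C"
      if "i \<in> {1, 2, 3}" "j \<in> {1, 2, 3}" "i \<noteq> j" "i \<noteq> s" "j \<noteq> s" "i \<in> C" "j \<in> C" for i j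
    proof -
      have "\<exists>s'\<in>S. s' \<in> C"
        using that by (intro balanced_two_T[OF C(3), of i j]) (simp_all only: in_T not_False_eq_True)
      then show ?thesis using s by blast
    qed
    have three: "s = 1 \<or> s = 2 \<or> s = 3" if "1 \<in> C" "2 \<in> C" "3 \<in> C"
    proof (rule ccontr)
      assume "\<not> ?thesis"
      then have "1 \<in> T" "2 \<in> T" "3 \<in> T" using in_ST s by auto
      then have "{1, 2, 3} \<subseteq> T \<inter> C" using that by blast
      then have "card {1, 2, 3 :: nat} \<le> card (T \<inter> C)" using finite_ST by (intro card_mono) auto
      moreover have "card (S \<inter> C) \<le> 1" using card_mono[of S "S \<inter> C"] finite_ST assms by simp
      moreover have "card {1, 2, 3 :: nat} = 3" by simp
      moreover have "excess S T C \<le> 1" using C(3) by auto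
      ultimately show False unfolding excess_def by linarith
    qed
    have cardC: "card ({1, 2, 3} \<inter> C) = of_bool (1 \<in> C) + of_bool (2 \<in> C) + of_bool (3 \<in> C)"
      by (simp add: Int_insert_left)
    have mem: "s = 1 \<Longrightarrow> 2 \<in> C \<Longrightarrow> 3 \<in> C \<Longrightarrow> 1 \<in> C" "s = 2 \<Longrightarrow> 1 \<in> C \<Longrightarrow> 3 \<in> C \<Longrightarrow> 2 \<in> C"
      "s = 3 \<Longrightarrow> 1 \<in> C \<Longrightarrow> 2 \<in> C \<Longrightarrow> 3 \<in> C"
      using two[of 2 3] two[of 1 3] two[of 1 2] by simp_all
    consider "s = 1" | "s = 2" | "s = 3" | "s \<noteq> 1" "s \<noteq> 2" "s \<noteq> 3" by blast
    then show ?thesis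
      unfolding g_def cluster_weight_small_triangle[OF C(1,2)] cardC a_def
      using mem three by cases (cases "1 \<in> C"; cases "2 \<in> C"; cases "3 \<in> C"; simp)+
  qed
  have total: "(\<Sum>C\<in>\<pi>. 1 - real (card ({1, 2, 3} \<inter> C))) = real K - 3" if "tight K \<pi>" for \<pi>
  proof -
    have "(\<Sum>C\<in>\<pi>. card ({1, 2, 3} \<inter> C)) = card {1, 2, 3 :: nat}"
      using n_ge_5 by (intro sum_card_Int_K_partition[OF tightD(1)[OF that]]) auto
    then show ?thesis
      using K_partitionD(3)[OF tightD(1)[OF that]] by (simp add: sum_subtractf flip: of_nat_sum)
  qed
  obtain \<gamma> where \<gamma>: "\<And>y. y \<in> coords n \<Longrightarrow> g y = \<gamma> * two_partition_coeff S T y"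
    using unique'[of g "\<lambda>C. 1 - real (card ({1, 2, 3} \<inter> C))" "real K - 3"] weight total by metis
  have "Rep 4 \<in> coords n" using n_ge_5 by (intro Rep_in_coords) auto
  then show False using \<gamma>[of "Rep 4"] by (simp add: g_def small_triangle_def edge_indicator_def)
qed

text \<open>If \<open>s\<close> exceeds all of \<open>T\<close>, it is never a representative,
  because its cluster contains a vertex of \<open>T\<close>. For \<open>s \<ge> 4\<close> its
  variable is then constantly 0; a smaller \<open>s\<close> has no variable, and condition (iv) is
  used instead.\<close>

lemma larger_T:
  assumes s: "s \<in> S"
  shows "\<exists>t\<in>T. s < t"
proof (rule ccontr)
  assume "\<not> ?thesis"
  then have less: "t < s" if "t \<in> T" for t using that S_neq_T[OF s] by (meson linorder_neqE_nat)
  show False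
  proof (cases "4 \<le> s")
    case True
    define g :: "coord \<Rightarrow> real" where "g y = (case y of Edge e \<Rightarrow> 0 | Rep u \<Rightarrow> of_bool (u = s))" for y
    have weight: "cluster_weight g C = 0"
      if C: "finite C" "C \<noteq> {}" "balanced C" for C
    proof -
      have "Min C \<noteq> s"
      proof
        assume "Min C = s"
        then have "s \<in> C" using Min_in[OF C(1,2)] by simp
        then obtain t where "t \<in> T" "t \<in> C" using balanced_member_T[OF C(3) s] by blast
        then show False using less \<open>Min C = s\<close> Min_le[OF C(1)] by fastforce
      qed
      then show ?thesis by (simp add: cluster_weight_def g_def cong: if_cong)
    qed
    obtain \<gamma> where \<gamma>: "\<And>y. y \<in> coords n \<Longrightarrow> g y = \<gamma> * two_partition_coeff S T y"
      using unique'[of g "\<lambda>_. 0" 0] weight by (metis sum.neutral_const)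
    have "Rep s \<in> coords n" using True s S by (intro Rep_in_coords) auto
    then show False using \<gamma>[of "Rep s"] by (simp add: g_def)
  next
    case False
    \<comment> \<open>At least two vertices of \<open>T\<close> lie below \<open>s \<le> 3\<close>,
      so \<open>s = 3\<close> and \<open>T = {1, 2}\<close>. Then \<open>S = {3}\<close>, and no
      vertex is left for condition (iv).\<close>
    have "T \<subseteq> {1..<s}" using less T by auto
    then have "card T \<le> s - 1" using card_mono[of "{1..<s}" T] by simp
    then have "s = 3" "card T = 2" using False card_T_ge_2 by linarith+
    have "T = {1..<s}"
      using \<open>T \<subseteq> {1..<s}\<close> \<open>s = 3\<close> \<open>card T = 2\<close> by (intro card_subset_eq) auto
    moreover have "card S = 1" using card_S_pos excess_in_range \<open>card T = 2\<close> by auto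
    ultimately show False using free_small_vertex s \<open>s = 3\<close> by auto
  qed
qed

end

section \<open>The equivalence, from uniqueness of the equation on tight partitions\<close>

theorem theorem6p4:
  fixes n K :: nat
    and S T U :: "nat set"
    and idx :: "coord \<Rightarrow> 'c::finite"
  assumes idx: "bij_betw idx (coords n) (UNIV :: 'c set)"
    and full_dim: "full_dimensional (partition_polytope idx n K)"
    and S: "S \<subseteq> {1..n}" "S \<noteq> {}"
    and T: "T \<subseteq> {1..n}" "T \<noteq> {}"
    and disj: "S \<inter> T = {}"
    and U: "U = {1..n} - (S \<union> T)"
    and le: "card S \<le> card T"
  shows "facet_defining (partition_polytope idx n K) (two_partition_lhs idx S T)
           (real (min (card S) (card T)))
       \<longleftrightarrow>
         int (card T) - int (card S) \<in> {1..int K - 1}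
       \<and> int (card S) \<le> int n - (int K + 2)
       \<and> (\<forall>s\<in>S. \<exists>t\<in>T. t > s)
       \<and> (card S = 1 \<longrightarrow> (\<exists>u. u \<in> U \<inter> {1, 2, 3}))"
proof -
  interpret vertex_pair n S T using S T disj by unfold_locales
  have pos: "1 \<le> card S" "1 \<le> card T"
    using S T finite_ST by (simp_all add: Suc_leI card_gt_0_iff)
  have "card (S \<union> T) \<le> n" using card_mono[of "{1..n}" "S \<union> T"] S T by simp
  then have "2 \<le> n" using pos finite_ST disj by (simp add: card_Un_disjoint)
  then have K2: "2 \<le> K" by (rule full_dimensional_K_ge_2[OF idx full_dim])
  have min: "min (card S) (card T) = card S" using le by simp
  show ?thesis
    unfolding min facet_iff_unique_equation[OF idx full_dim]
  proof (intro iffI; (elim conjE exE)?)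
    fix \<pi>
    assume tight: "tight K \<pi>" and unique:
      "\<forall>g d. (\<forall>\<pi>. tight K \<pi> \<longrightarrow> (\<Sum>C\<in>\<pi>. cluster_weight g C) = d) \<longrightarrow>
        (\<exists>\<gamma>. \<forall>y\<in>coords n. g y = \<gamma> * two_partition_coeff S T y)"
    interpret facet_necessity n S T K \<pi>
      using tight K2 unique by unfold_locales blast+
    have "\<exists>u. u \<in> U \<inter> {1, 2, 3}" if one: "card S = 1"
    proof -
      obtain u where u: "u \<in> {1, 2, 3}" "u \<notin> S" "u \<notin> T" using free_small_vertex[OF one] by blast
      then have "u \<in> {1..n}" using n_ge_5 by auto
      then show ?thesis using u U by blast
    qed
    then show "int (card T) - int (card S) \<in> {1..int K - 1}
       \<and> int (card S) \<le> int n - (int K + 2)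
       \<and> (\<forall>s\<in>S. \<exists>t\<in>T. t > s)
       \<and> (card S = 1 \<longrightarrow> (\<exists>u. u \<in> U \<inter> {1, 2, 3}))"
      using excess_in_range card_S_bound larger_T by blast
  next
    assume i: "int (card T) - int (card S) \<in> {1..int K - 1}"
      and ii: "int (card S) \<le> int n - (int K + 2)"
      and iii: "\<forall>s\<in>S. \<exists>t\<in>T. t > s"
      and iv: "card S = 1 \<longrightarrow> (\<exists>u. u \<in> U \<inter> {1, 2, 3})"
    \<comment> \<open>Condition (ii) makes \<open>n\<close> large enough to exclude
      \<open>K = 2\<close> by full dimension; \<open>K \<ge> 3\<close> leaves at least one further
      cluster in \<open>exchange\<close>.\<close>
    have "3 \<le> n" using ii K2 by linarith
    then have K3: "3 \<le> K" using K2 full_dimensional_K_neq_2[OF idx full_dim] by fastforce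
    have "\<exists>\<pi>. partition_on {1..n} \<pi> \<and> card \<pi> = K \<and> (\<forall>C\<in>\<pi>. balanced C)"
    proof (rule balanced_partition_exists)
      have "excess S T {1..n} = int (card T) - int (card S)"
        using S T by (simp add: excess_def Int_absorb2)
      then show "0 \<le> excess S T {1..n}" "excess S T {1..n} \<le> int K" using i by auto
      show "K \<le> card ({1..n} - S)"
        using S finite_ST ii by (simp add: card_Diff_subset)
    qed (use K3 in auto)
    then have "\<exists>\<pi>. tight K \<pi>" by (simp add: tight_def K_partition_def)
    moreover have "\<exists>\<gamma>. \<forall>y\<in>coords n. g y = \<gamma> * two_partition_coeff S T y"
      if eq: "\<And>\<pi>. tight K \<pi> \<Longrightarrow> (\<Sum>C\<in>\<pi>. cluster_weight g C) = d" for g d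
    proof -
      interpret facet_conditions n S T K g d
      proof unfold_locales
        show "card S < card T" "card T < card S + K" using i by auto
        show "card S + K + 2 \<le> n" using ii by linarith
        show "\<exists>t\<in>T. s < t" if "s \<in> S" for s using iii that by blast
        show "\<exists>u\<in>{1, 2, 3}. u \<notin> S \<and> u \<notin> T" if "card S = 1" using iv that U by blast
      qed (use K3 eq in auto)
      show ?thesis by (rule equation_unique)
    qed
    ultimately show "(\<exists>\<pi>. tight K \<pi>) \<and>
      (\<forall>g d. (\<forall>\<pi>. tight K \<pi> \<longrightarrow> (\<Sum>C\<in>\<pi>. cluster_weight g C) = d) \<longrightarrow>
        (\<exists>\<gamma>. \<forall>y\<in>coords n. g y = \<gamma> * two_partition_coeff S T y))" by blast
  qed
qed

end
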